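(* Let $\big\{\{\mathbf{F}_i^{(j)}\}_{i=1}^L,\mathbf{G}^{(j)}\big\}_{j\ge 0}$ be any sequence generated by the 2-BCD algorithm (defined in the context), and let $\mathsf{MSE}^{(j)}=\mathsf{MSE}\big(\{\mathbf{F}_i^{(j)}\}_{i=1}^L,\mathbf{G}^{(j)}\big)$. Then the objective sequence $\{\mathsf{MSE}^{(j)}\}_{j=0}^\infty$ is monotonically decreasing (i.e. $\mathsf{MSE}^{(j+1)}\le\mathsf{MSE}^{(j)}$ for all $j$). If moreover, for every $i\in\{1,\dots,L\}$, $\mathbf{K}_i\mathbf{\Sigma}_{\mathbf{s}}\mathbf{K}_i^H\succ 0$ or $\mathbf{\Sigma}_i\succ 0$, then the solution sequence $\big\{\{\mathbf{F}_i^{(j)}\}_{i=1}^L,\mathbf{G}^{(j)}\big\}_{j=1}^\infty$ has limit points, and each of its limit points is a stationary point of the problem $(\mathsf{P}0)$.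
   Context: Setting. Positive integers $L,M,K$ and $N_i,J_i$ ($i=1,\dots,L$) are given, together with complex matrices $\mathbf{K}_i\in\mathbb{C}^{J_i\times K}$, $\mathbf{H}_i\in\mathbb{C}^{M\times N_i}$, Hermitian positive semidefinite (covariance) matrices $\mathbf{\Sigma}_{\mathbf{s}}\in\mathbb{C}^{K\times K}$ and $\mathbf{\Sigma}_i\in\mathbb{C}^{J_i\times J_i}$, and reals $\sigma_0^2>0$, $P_i>0$. For $\mathbf{F}_i\in\mathbb{C}^{N_i\times J_i}$ and $\mathbf{G}\in\mathbb{C}^{M\times K}$ put $\mathbf{S}=\sum_{i=1}^L\mathbf{H}_i\mathbf{F}_i\mathbf{K}_i$ and $$\mathsf{MSE}\big(\{\mathbf{F}_i\}_{i=1}^L,\mathbf{G}\big)=\mathrm{Tr}\Big\{\mathbf{G}^H\mathbf{S}\mathbf{\Sigma}_{\mathbf{s}}\mathbf{S}^H\mathbf{G}-\mathbf{G}^H\mathbf{S}\mathbf{\Sigma}_{\mathbf{s}}-\mathbf{\Sigma}_{\mathbf{s}}\mathbf{S}^H\mathbf{G}+\sum_{i=1}^L\mathbf{G}^H\mathbf{H}_i\mathbf{F}_i\mathbf{\Sigma}_i\mathbf{F}_i^H\mathbf{H}_i^H\mathbf{G}+\sigma_0^2\mathbf{G}^H\mathbf{G}+\mathbf{\Sigma}_{\mathbf{s}}\Big\}.$$ Problem $(\mathsf{P}0)$: minimize $\mathsf{MSE}\big(\{\mathbf{F}_i\}_{i=1}^L,\mathbf{G}\big)$ over all $\mathbf{F}_i\in\mathbb{C}^{N_i\times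 J_i}$, $\mathbf{G}\in\mathbb{C}^{M\times K}$ subject to $\mathrm{Tr}\{\mathbf{F}_i(\mathbf{K}_i\mathbf{\Sigma}_{\mathbf{s}}\mathbf{K}_i^H+\mathbf{\Sigma}_i)\mathbf{F}_i^H\}\le P_i$ for $i=1,\dots,L$. A tuple $\{\mathbf{F}_i\}$ satisfying these constraints is called feasible. Optimal receiver: for given $\{\mathbf{F}_i\}$, the unique minimizer of $\mathsf{MSE}$ over $\mathbf{G}$ is $$\mathbf{G}^\star(\{\mathbf{F}_i\})=\Big[\mathbf{S}\mathbf{\Sigma}_{\mathbf{s}}\mathbf{S}^H+\sigma_0^2\mathbf{I}_M+\sum_{i=1}^L\mathbf{H}_i\mathbf{F}_i\mathbf{\Sigma}_i\mathbf{F}_i^H\mathbf{H}_i^H\Big]^{-1}\mathbf{S}\mathbf{\Sigma}_{\mathbf{s}}.$$ 2-BCD algorithm (run indefinitely). Start with an arbitrary feasible $\{\mathbf{F}_i^{(0)}\}_{i=1}^L$ and $\mathbf{G}^{(0)}=\mathbf{G}^\star(\{\mathbf{F}_i^{(0)}\})$. For $j=1,2,\dots$: let $\{\mathbf{F}_i^{(j)}\}_{i=1}^L$ be an optimal solution of the problem of minimizing $\mathsf{MSE}\big(\{\mathbf{F}_i\}_{i=1}^L,\mathbf{G}^{(j-1)}\big)$ over all feasible $\{\mathbf{F}_i\}_{i=1}^L$; then let $\mathbf{G}^{(j)}=\mathbf{G}^\star(\{\mathbf{F}_i^{(j)}\})$. Stationary point. For a problem $\min\{f(\mathbf{x})\mid\mathbf{x}\in\mathcal{X}\}$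 with $f$ continuously differentiable and $\mathcal{X}$ closed and nonempty, $\mathbf{x}_0\in\mathcal{X}$ is a stationary point iff $\nabla f(\mathbf{x}_0)(\mathbf{x}-\mathbf{x}_0)\ge 0$ for all $\mathbf{x}\in\mathcal{X}$; complex variables are identified with their real and imaginary parts, so this says the (real) directional derivative of $f$ at $\mathbf{x}_0$ in direction $\mathbf{x}-\mathbf{x}_0$ is nonnegative. A limit point of a sequence is the limit of some convergent subsequence. $\mathbf{X}\succ 0$ means Hermitian positive definite. *)

theory Defs
  imports Complex_Main "Jordan_Normal_Form.Schur_Decomposition"
    "Jordan_Normal_Form.Gauss_Jordan_Elimination"
begin

text \<open>
  The dimensions \<open>N\<^sub>i\<close>, \<open>J\<^sub>i\<close> vary with \<open>i\<close>, hence matrices with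
  explicit carriers. An indexed family is a function on \<^typ>\<open>nat\<close>; only its values on
  \<open>{1..L}\<close> are ever used. The Hermitian transpose is \<^const>\<open>mat_adjoint\<close>.
\<close>

definition mat_trace :: "complex mat \<Rightarrow> complex" where
  "mat_trace A = (\<Sum>k<dim_row A. A $$ (k, k))"

definition mat_sum :: "nat \<Rightarrow> nat \<Rightarrow> (nat \<Rightarrow> complex mat) \<Rightarrow> nat set \<Rightarrow> complex mat" where
  "mat_sum nr nc A I = mat nr nc (\<lambda>(a, b). \<Sum>i\<in>I. A i $$ (a, b))"

definition hermitian_mat :: "nat \<Rightarrow> complex mat \<Rightarrow> bool" where
  "hermitian_mat n A \<longleftrightarrow> A \<in> carrier_mat n n \<and> mat_adjoint A = A"

text \<open>
  The quadratic form \<open>v\<^sup>H A v\<close> is \<open>(A *\<^sub>v v) \<bullet>c v\<close>, which is real for Hermitian \<open>A\<close>.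
\<close>

definition psd_mat :: "nat \<Rightarrow> complex mat \<Rightarrow> bool" where
  "psd_mat n A \<longleftrightarrow> hermitian_mat n A \<and>
     (\<forall>v\<in>carrier_vec n. 0 \<le> Re ((A *\<^sub>v v) \<bullet>c v))"

definition pd_mat :: "nat \<Rightarrow> complex mat \<Rightarrow> bool" where
  "pd_mat n A \<longleftrightarrow> hermitian_mat n A \<and>
     (\<forall>v\<in>carrier_vec n. v \<noteq> 0\<^sub>v n \<longrightarrow> 0 < Re ((A *\<^sub>v v) \<bullet>c v))"

record wsn =
  n_sensors :: nat                        \<comment> \<open>\<open>L\<close>\<close>
  rx_dim :: nat                           \<comment> \<open>\<open>M\<close>\<close>
  src_dim :: nat                          \<comment> \<open>\<open>K\<close>\<close>
  tx_dim :: "nat \<Rightarrow> nat"                  \<comment> \<open>\<open>N\<^sub>i\<close>\<close>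
  obs_dim :: "nat \<Rightarrow> nat"                 \<comment> \<open>\<open>J\<^sub>i\<close>\<close>
  obs_mat :: "nat \<Rightarrow> complex mat"         \<comment> \<open>\<open>K\<^sub>i\<close>\<close>
  chan_mat :: "nat \<Rightarrow> complex mat"        \<comment> \<open>\<open>H\<^sub>i\<close>\<close>
  src_cov :: "complex mat"                \<comment> \<open>\<open>\<Sigma>\<^sub>s\<close>\<close>
  noise_cov :: "nat \<Rightarrow> complex mat"       \<comment> \<open>\<open>\<Sigma>\<^sub>i\<close>\<close>
  rx_noise_var :: real                    \<comment> \<open>\<open>\<sigma>\<^sub>0\<^sup>2\<close>, the variance itself\<close>
  tx_power :: "nat \<Rightarrow> real"               \<comment> \<open>\<open>P\<^sub>i\<close>\<close>

definition sensors :: "wsn \<Rightarrow> nat set" where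
  "sensors W = {1..n_sensors W}"

definition valid_wsn :: "wsn \<Rightarrow> bool" where
  "valid_wsn W \<longleftrightarrow>
     0 < n_sensors W \<and> 0 < rx_dim W \<and> 0 < src_dim W \<and>
     psd_mat (src_dim W) (src_cov W) \<and> 0 < rx_noise_var W \<and>
     (\<forall>i\<in>sensors W.
        0 < tx_dim W i \<and> 0 < obs_dim W i \<and>
        obs_mat W i \<in> carrier_mat (obs_dim W i) (src_dim W) \<and>
        chan_mat W i \<in> carrier_mat (rx_dim W) (tx_dim W i) \<and>
        psd_mat (obs_dim W i) (noise_cov W i) \<and>
        0 < tx_power W i)"

definition precoders :: "wsn \<Rightarrow> (nat \<Rightarrow> complex mat) set" where
  "precoders W = {F. \<forall>i\<in>sensors W. F i \<in> carrier_mat (tx_dim W i) (obs_dim W i)}"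

definition receivers :: "wsn \<Rightarrow> complex mat set" where
  "receivers W = carrier_mat (rx_dim W) (src_dim W)"

definition obs_signal_cov :: "wsn \<Rightarrow> nat \<Rightarrow> complex mat" where
  "obs_signal_cov W i = obs_mat W i * src_cov W * mat_adjoint (obs_mat W i)"

definition S_mat :: "wsn \<Rightarrow> (nat \<Rightarrow> complex mat) \<Rightarrow> complex mat" where
  "S_mat W F = mat_sum (rx_dim W) (src_dim W) (\<lambda>i. chan_mat W i * F i * obs_mat W i) (sensors W)"

text \<open>
  The traces below are real when \<open>W\<close> is valid and \<open>F\<close>, \<open>G\<close> have the right dimensions;
  \<^const>\<open>Re\<close> only changes the type.
\<close>

definition MSE :: "wsn \<Rightarrow> (nat \<Rightarrow> complex mat) \<Rightarrow> complex mat \<Rightarrow> real" where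
  "MSE W F G = (let S = S_mat W F; \<Sigma>s = src_cov W; GH = mat_adjoint G in
     Re (mat_trace
       (GH * S * \<Sigma>s * mat_adjoint S * G - GH * S * \<Sigma>s - \<Sigma>s * mat_adjoint S * G
        + mat_sum (src_dim W) (src_dim W)
            (\<lambda>i. GH * chan_mat W i * F i * noise_cov W i * mat_adjoint (F i)
                  * mat_adjoint (chan_mat W i) * G) (sensors W)
        + complex_of_real (rx_noise_var W) \<cdot>\<^sub>m (GH * G)
        + \<Sigma>s)))"

definition feasible :: "wsn \<Rightarrow> (nat \<Rightarrow> complex mat) \<Rightarrow> bool" where
  "feasible W F \<longleftrightarrow> F \<in> precoders W \<and>
     (\<forall>i\<in>sensors W.
        Re (mat_trace (F i * (obs_signal_cov W i + noise_cov W i) * mat_adjoint (F i)))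
          \<le> tx_power W i)"

text \<open>
  The matrix inverted here is positive definite when \<open>W\<close> is valid, so
  \<^const>\<open>mat_inverse\<close> does not return \<^const>\<open>None\<close>.
\<close>

definition G_opt :: "wsn \<Rightarrow> (nat \<Rightarrow> complex mat) \<Rightarrow> complex mat" where
  "G_opt W F = (let S = S_mat W F; \<Sigma>s = src_cov W in
     the (mat_inverse
       (S * \<Sigma>s * mat_adjoint S
        + complex_of_real (rx_noise_var W) \<cdot>\<^sub>m 1\<^sub>m (rx_dim W)
        + mat_sum (rx_dim W) (rx_dim W)
            (\<lambda>i. chan_mat W i * F i * noise_cov W i * mat_adjoint (F i)
                  * mat_adjoint (chan_mat W i)) (sensors W)))
     * (S * \<Sigma>s))"

definition optimal_precoders :: "wsn \<Rightarrow> complex mat \<Rightarrow> (nat \<Rightarrow> complex mat) \<Rightarrow> bool" where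
  "optimal_precoders W G F \<longleftrightarrow>
     feasible W F \<and> (\<forall>F'. feasible W F' \<longrightarrow> MSE W F G \<le> MSE W F' G)"

definition two_bcd ::
  "wsn \<Rightarrow> (nat \<Rightarrow> nat \<Rightarrow> complex mat) \<Rightarrow> (nat \<Rightarrow> complex mat) \<Rightarrow> bool" where
  "two_bcd W F G \<longleftrightarrow>
     feasible W (F 0) \<and> G 0 = G_opt W (F 0) \<and>
     (\<forall>j. optimal_precoders W (G j) (F (Suc j)) \<and> G (Suc j) = G_opt W (F (Suc j)))"

definition mat_tendsto :: "(nat \<Rightarrow> complex mat) \<Rightarrow> complex mat \<Rightarrow> bool" where
  "mat_tendsto X A \<longleftrightarrow>
     (\<forall>a<dim_row A. \<forall>b<dim_col A. (\<lambda>n. X n $$ (a, b)) \<longlonglongrightarrow> A $$ (a, b))"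

definition limit_point ::
  "wsn \<Rightarrow> (nat \<Rightarrow> nat \<Rightarrow> complex mat) \<Rightarrow> (nat \<Rightarrow> complex mat)
     \<Rightarrow> (nat \<Rightarrow> complex mat) \<Rightarrow> complex mat \<Rightarrow> bool" where
  "limit_point W F G F' G' \<longleftrightarrow>
     F' \<in> precoders W \<and> G' \<in> receivers W \<and>
     (\<exists>r. strict_mono (r :: nat \<Rightarrow> nat) \<and>
          (\<forall>i\<in>sensors W. mat_tendsto (\<lambda>n. F (r n) i) (F' i)) \<and>
          mat_tendsto (\<lambda>n. G (r n)) G')"

text \<open>
  \<open>D\<close> is the real directional derivative of the objective at \<open>(F, G)\<close> in the
  direction \<open>(F', G') - (F, G)\<close>.
\<close>

definition stationary_point :: "wsn \<Rightarrow> (nat \<Rightarrow> complex mat) \<Rightarrow> complex mat \<Rightarrow> bool" where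
  "stationary_point W F G \<longleftrightarrow>
     feasible W F \<and> G \<in> receivers W \<and>
     (\<forall>F' G'. feasible W F' \<and> G' \<in> receivers W \<longrightarrow>
        (\<exists>D\<ge>0. ((\<lambda>t::real. MSE W (\<lambda>i. F i + complex_of_real t \<cdot>\<^sub>m (F' i - F i))
                                  (G + complex_of_real t \<cdot>\<^sub>m (G' - G)))
                 has_real_derivative D) (at 0)))"

end

theory Submission
  imports Defs "HOL-Analysis.Product_Vector"
    "HOL-Computational_Algebra.Fundamental_Theorem_Algebra"
begin

text \<open>
  Every limit point \<open>(F', G')\<close> minimises the error in each block separately. For the receiver this is the
  limit of \<open>MSE(F\<^sup>j, G\<^sup>j) \<le> MSE(F\<^sup>j, G)\<close>. For the precoders, the objective values decrease to the
  value at the limit point, so that \<open>MSE(F', G') \<le> MSE(F\<^sup>j\<^sup>+\<^sup>1, G\<^sup>j) \<le> MSE(F, G\<^sup>j)\<close> for all \<open>j\<close> and all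
  feasible \<open>F\<close>; no convergence of the shifted subsequence \<open>F\<^sup>j\<^sup>+\<^sup>1\<close> is needed. As the error is
  differentiable and the constraints are convex and decoupled from \<open>G\<close>, minimality in each
  block gives stationarity.

  Limit points exist because the iterates are bounded: the power constraint with a positive definite
  covariance bounds \<open>F\<close>, and \<open>\<sigma>\<^sub>0\<^sup>2 \<parallel>G\<parallel>\<^sup>2 \<le> MSE(F, G) \<le> MSE(F, 0)\<close> bounds the optimal receiver.
\<close>

subsection \<open>Complex matrices and the Frobenius inner product\<close>

lemma mat_adjoint_dim [simp]:
  "dim_row (mat_adjoint A) = dim_col A" "dim_col (mat_adjoint A) = dim_row A"
  by (auto simp: mat_adjoint_def)

lemma mat_adjoint_index [simp]:
  fixes A :: "complex mat"
  shows "i < dim_col A \<Longrightarrow> j < dim_row A \<Longrightarrow> mat_adjoint A $$ (i, j) = cnj (A $$ (j, i))"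
  by (simp add: mat_adjoint_def mat_of_rows_index)

lemma mat_adjoint_carrier [simp, intro]:
  "A \<in> carrier_mat n m \<Longrightarrow> mat_adjoint A \<in> carrier_mat m n"
  by auto

lemma mat_adjoint_adjoint [simp]:
  fixes A :: "complex mat"
  shows "mat_adjoint (mat_adjoint A) = A"
  by (rule eq_matI) auto

lemma mat_adjoint_mult:
  fixes A :: "complex mat"
  assumes "A \<in> carrier_mat n k" "B \<in> carrier_mat k m"
  shows "mat_adjoint (A * B) = mat_adjoint B * mat_adjoint A"
  using assms
  by (intro eq_matI) (auto simp: scalar_prod_def mult.commute)

lemma mat_adjoint_add:
  fixes A :: "complex mat"
  assumes "A \<in> carrier_mat n m" "B \<in> carrier_mat n m"
  shows "mat_adjoint (A + B) = mat_adjoint A + mat_adjoint B"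
  using assms by (intro eq_matI) auto

lemma mat_adjoint_smult:
  fixes A :: "complex mat"
  shows "mat_adjoint (c \<cdot>\<^sub>m A) = cnj c \<cdot>\<^sub>m mat_adjoint A"
  by (intro eq_matI) auto

lemma mat_adjoint_one [simp]: "mat_adjoint (1\<^sub>m n :: complex mat) = 1\<^sub>m n"
  by (intro eq_matI) auto

lemma mat_sum_carrier [simp, intro]: "mat_sum n m A I \<in> carrier_mat n m"
  by (simp add: mat_sum_def)

lemma mat_sum_dim [simp]: "dim_row (mat_sum n m A I) = n" "dim_col (mat_sum n m A I) = m"
  by (auto simp: mat_sum_def)

lemma mat_sum_index [simp]:
  "a < n \<Longrightarrow> b < m \<Longrightarrow> mat_sum n m A I $$ (a, b) = (\<Sum>i\<in>I. A i $$ (a, b))"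
  by (simp add: mat_sum_def)

lemma mat_sum_cong:
  "(\<And>i. i \<in> I \<Longrightarrow> A i = B i) \<Longrightarrow> mat_sum n m A I = mat_sum n m B I"
  by (intro eq_matI) auto

lemma mat_adjoint_mat_sum:
  assumes "\<And>i. i \<in> I \<Longrightarrow> A i \<in> carrier_mat n m"
  shows "mat_adjoint (mat_sum n m A I) = mat_sum m n (\<lambda>i. mat_adjoint (A i)) I"
proof -
  have "dim_row (A i) = n" "dim_col (A i) = m" if "i \<in> I" for i
    using assms[OF that] by auto
  then show ?thesis by (intro eq_matI) (auto intro!: sum.cong)
qed

lemma mult_mat_sum:
  assumes "X \<in> carrier_mat k n" "\<And>i. i \<in> I \<Longrightarrow> A i \<in> carrier_mat n m"
  shows "X * mat_sum n m A I = mat_sum k m (\<lambda>i. X * A i) I"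
proof (rule eq_matI, goal_cases)
  case (1 a b)
  with assms have "(X * mat_sum n m A I) $$ (a, b)
      = (\<Sum>l<n. \<Sum>i\<in>I. X $$ (a, l) * A i $$ (l, b))"
    by (auto simp: scalar_prod_def sum_distrib_left lessThan_atLeast0)
  also have "\<dots> = (\<Sum>i\<in>I. \<Sum>l<n. X $$ (a, l) * A i $$ (l, b))"
    by (rule sum.swap)
  also have "\<dots> = (\<Sum>i\<in>I. (X * A i) $$ (a, b))"
    using assms 1 by (intro sum.cong) (auto simp: scalar_prod_def lessThan_atLeast0 dest!: assms(2))
  finally show ?case using 1 by simp
qed (use assms in auto)

lemma mat_sum_mult:
  assumes "X \<in> carrier_mat m k" "\<And>i. i \<in> I \<Longrightarrow> A i \<in> carrier_mat n m"
  shows "mat_sum n m A I * X = mat_sum n k (\<lambda>i. A i * X) I"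
proof (rule eq_matI, goal_cases)
  case (1 a b)
  with assms have "(mat_sum n m A I * X) $$ (a, b)
      = (\<Sum>l<m. \<Sum>i\<in>I. A i $$ (a, l) * X $$ (l, b))"
    by (auto simp: scalar_prod_def sum_distrib_right lessThan_atLeast0)
  also have "\<dots> = (\<Sum>i\<in>I. \<Sum>l<m. A i $$ (a, l) * X $$ (l, b))"
    by (rule sum.swap)
  also have "\<dots> = (\<Sum>i\<in>I. (A i * X) $$ (a, b))"
    using assms 1 by (intro sum.cong) (auto simp: scalar_prod_def lessThan_atLeast0 dest!: assms(2))
  finally show ?case using 1 by simp
qed (use assms in auto)

lemma mat_trace_add:
  "A \<in> carrier_mat n n \<Longrightarrow> B \<in> carrier_mat n n \<Longrightarrow> mat_trace (A + B) = mat_trace A + mat_trace B"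
  by (auto simp: mat_trace_def sum.distrib)

lemma mat_trace_diff:
  "A \<in> carrier_mat n n \<Longrightarrow> B \<in> carrier_mat n n \<Longrightarrow> mat_trace (A - B) = mat_trace A - mat_trace B"
  by (auto simp: mat_trace_def sum_subtractf)

lemma mat_trace_smult:
  "A \<in> carrier_mat n n \<Longrightarrow> mat_trace (c \<cdot>\<^sub>m A) = c * mat_trace A"
  by (auto simp: mat_trace_def sum_distrib_left)

lemma mat_trace_mat_sum:
  assumes "\<And>i. i \<in> I \<Longrightarrow> A i \<in> carrier_mat n n"
  shows "mat_trace (mat_sum n n A I) = (\<Sum>i\<in>I. mat_trace (A i))"
proof -
  have "mat_trace (mat_sum n n A I) = (\<Sum>i\<in>I. \<Sum>k<n. A i $$ (k, k))"
    by (simp add: mat_trace_def sum.swap[of _ I])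
  also have "\<dots> = (\<Sum>i\<in>I. mat_trace (A i))"
    using assms by (intro sum.cong) (auto simp: mat_trace_def dest!: assms)
  finally show ?thesis .
qed

text \<open>Conjugate-linear in the first argument, so that the trace of \<open>G^H R G\<close> is
  \<open>frob G (R * G)\<close> and cyclic permutations under the trace become moves of a factor
  from one argument to the other.\<close>

definition frob :: "complex mat \<Rightarrow> complex mat \<Rightarrow> complex" where
  "frob A B = mat_trace (mat_adjoint A * B)"

lemma frob_sum:
  assumes "A \<in> carrier_mat n m" "B \<in> carrier_mat n m"
  shows "frob A B = (\<Sum>b<m. \<Sum>a<n. cnj (A $$ (a, b)) * B $$ (a, b))"
  using assms by (auto simp: frob_def mat_trace_def scalar_prod_def lessThan_atLeast0)

lemma frob_cnj:
  assumes "A \<in> carrier_mat n m" "B \<in> carrier_mat n m"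
  shows "cnj (frob A B) = frob B A"
  using assms by (simp add: frob_sum mult.commute)

lemma frob_diff_right:
  assumes "A \<in> carrier_mat n m" "B \<in> carrier_mat n m" "C \<in> carrier_mat n m"
  shows "frob A (B - C) = frob A B - frob A C"
proof -
  have "B - C \<in> carrier_mat n m" using assms by auto
  with assms show ?thesis
    by (simp add: frob_sum[of _ n m] sum_subtractf right_diff_distrib)
qed

lemma frob_diff_left:
  assumes "A \<in> carrier_mat n m" "B \<in> carrier_mat n m" "C \<in> carrier_mat n m"
  shows "frob (A - B) C = frob A C - frob B C"
proof -
  have "A - B \<in> carrier_mat n m" using assms by auto
  with assms show ?thesis
    by (simp add: frob_sum[of _ n m] sum_subtractf left_diff_distrib)
qed

lemma frob_add_right:
  assumes "A \<in> carrier_mat n m" "B \<in> carrier_mat n m" "C \<in> carrier_mat n m"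
  shows "frob A (B + C) = frob A B + frob A C"
proof -
  have "B + C \<in> carrier_mat n m" using assms by auto
  with assms show ?thesis
    by (simp add: frob_sum[of _ n m] sum.distrib distrib_left)
qed

lemma frob_add_left:
  assumes "A \<in> carrier_mat n m" "B \<in> carrier_mat n m" "C \<in> carrier_mat n m"
  shows "frob (A + B) C = frob A C + frob B C"
proof -
  have "A + B \<in> carrier_mat n m" using assms by auto
  with assms show ?thesis
    by (simp add: frob_sum[of _ n m] sum.distrib distrib_right)
qed

lemma frob_smult_right:
  assumes "A \<in> carrier_mat n m" "B \<in> carrier_mat n m"
  shows "frob A (c \<cdot>\<^sub>m B) = c * frob A B"
proof -
  have "c \<cdot>\<^sub>m B \<in> carrier_mat n m" using assms by auto
  with assms show ?thesis
    by (simp add: frob_sum[of _ n m] sum_distrib_left mult.left_commute)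
qed

lemma frob_smult_left:
  assumes "A \<in> carrier_mat n m" "B \<in> carrier_mat n m"
  shows "frob (c \<cdot>\<^sub>m A) B = cnj c * frob A B"
proof -
  have "c \<cdot>\<^sub>m A \<in> carrier_mat n m" using assms by auto
  with assms show ?thesis
    by (simp add: frob_sum[of _ n m] sum_distrib_left mult.assoc)
qed

lemma frob_mat_sum_right:
  assumes "A \<in> carrier_mat n m" "\<And>i. i \<in> I \<Longrightarrow> B i \<in> carrier_mat n m"
  shows "frob A (mat_sum n m B I) = (\<Sum>i\<in>I. frob A (B i))"
  unfolding frob_def using assms
  by (subst mult_mat_sum[of _ m n]) (auto intro!: mat_trace_mat_sum mult_carrier_mat[of _ _ n])

lemma frob_mult_right:
  assumes "A \<in> carrier_mat n m" "X \<in> carrier_mat n k" "B \<in> carrier_mat k m"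
  shows "frob A (X * B) = frob (mat_adjoint X * A) B"
  unfolding frob_def using assms
  by (subst mat_adjoint_mult[of _ k n _ m]) (auto simp: assoc_mult_mat[of _ m n _ k _ m])

lemma frob_self:
  assumes "A \<in> carrier_mat n m"
  shows "frob A A = of_real (\<Sum>b<m. \<Sum>a<n. (cmod (A $$ (a, b)))\<^sup>2)"
  using assms by (simp add: frob_sum complex_norm_square mult.commute del: of_real_power)

lemma frob_self_ge:
  assumes "A \<in> carrier_mat n m" "a < n" "b < m"
  shows "(cmod (A $$ (a, b)))\<^sup>2 \<le> Re (frob A A)"
proof -
  have "(cmod (A $$ (a, b)))\<^sup>2 \<le> (\<Sum>a<n. (cmod (A $$ (a, b)))\<^sup>2)"
    using assms by (intro member_le_sum) auto
  also have "\<dots> \<le> (\<Sum>b<m. \<Sum>a<n. (cmod (A $$ (a, b)))\<^sup>2)"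
    using assms by (intro member_le_sum[where f="\<lambda>b. \<Sum>a<n. (cmod (A $$ (a, b)))\<^sup>2"]) (auto intro: sum_nonneg)
  finally show ?thesis using frob_self[OF assms(1)] by simp
qed

text \<open>Bridge between the two languages: \<open>psd_mat\<close> and \<open>pd_mat\<close> test
  vectors, while the error and the power are traces. The trace form is the sum of the vector forms
  over the columns.\<close>

lemma frob_columns:
  assumes P: "P \<in> carrier_mat n n" and A: "A \<in> carrier_mat n m"
  shows "frob A (P * A) = (\<Sum>b<m. (P *\<^sub>v col A b) \<bullet>c col A b)"
proof -
  have "frob A (P * A) = (\<Sum>b<m. \<Sum>a<n. cnj (A $$ (a, b)) * (P * A) $$ (a, b))"
    using assms by (intro frob_sum) auto
  also have "\<dots> = (\<Sum>b<m. (P *\<^sub>v col A b) \<bullet>c col A b)"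
    using assms by (intro sum.cong) (auto simp: scalar_prod_def lessThan_atLeast0 mult.commute)
  finally show ?thesis .
qed

section \<open>Hermitian, positive semidefinite and positive definite forms\<close>

lemma hermitian_frob:
  assumes "hermitian_mat n P" "A \<in> carrier_mat n m" "B \<in> carrier_mat n m"
  shows "frob A (P * B) = frob (P * A) B"
  using frob_mult_right[of A n m P n B] assms by (auto simp: hermitian_mat_def)

lemma psd_frob_nonneg:
  assumes "psd_mat n P" "A \<in> carrier_mat n m"
  shows "0 \<le> Re (frob A (P * A))"
proof -
  have "0 \<le> (\<Sum>b<m. Re ((P *\<^sub>v col A b) \<bullet>c col A b))"
    using assms by (intro sum_nonneg) (auto simp: psd_mat_def)
  then show ?thesis
    using assms by (subst frob_columns[of _ n]) (auto simp: psd_mat_def hermitian_mat_def)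
qed

text \<open>The bridge in the other direction: a vector is a matrix with one column. Definiteness
  can then be proved entirely within the calculus of \<open>frob\<close>.\<close>

lemma quad_form_eq_frob:
  assumes "P \<in> carrier_mat n n" "v \<in> carrier_vec n"
  shows "(P *\<^sub>v v) \<bullet>c v = frob (mat_of_cols n [v]) (P * mat_of_cols n [v])"
  using assms by (subst frob_columns[of _ n _ 1]) auto

lemma psd_matI:
  assumes "hermitian_mat n P"
    and "\<And>A. A \<in> carrier_mat n 1 \<Longrightarrow> 0 \<le> Re (frob A (P * A))"
  shows "psd_mat n P"
  unfolding psd_mat_def
proof (intro conjI ballI)
  fix v :: "complex vec" assume v: "v \<in> carrier_vec n"
  have "mat_of_cols n [v] \<in> carrier_mat n 1" by (simp add: mat_of_cols_carrier(1)[of n "[v]", simplified])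
  then show "0 \<le> Re ((P *\<^sub>v v) \<bullet>c v)"
    using assms v by (subst quad_form_eq_frob[of _ n]) (auto simp: hermitian_mat_def)
qed fact

lemma pd_imp_psd: "pd_mat n P \<Longrightarrow> psd_mat n P"
  unfolding pd_mat_def psd_mat_def
  by (metis carrier_matD hermitian_mat_def less_imp_le order_refl mult_mat_vec_carrier
      conjugate_square_positive scalar_prod_right_zero conjugate_zero_vec zero_carrier_vec zero_complex.sel(1))

lemma pd_mat_inverse:
  assumes "pd_mat n P"
  obtains Q where "Q \<in> carrier_mat n n" "P * Q = 1\<^sub>m n" "mat_inverse P = Some Q"
proof -
  have P: "P \<in> carrier_mat n n" using assms by (simp add: pd_mat_def hermitian_mat_def)
  \<comment> \<open>A kernel vector would make the positive form vanish.\<close>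
  have "det P \<noteq> 0"
  proof
    assume "det P = 0"
    then obtain v where v: "v \<in> carrier_vec n" "v \<noteq> 0\<^sub>v n" "P *\<^sub>v v = 0\<^sub>v n"
      using det_0_iff_vec_prod_zero_field[OF P] by blast
    then have "0 < Re ((P *\<^sub>v v) \<bullet>c v)" using assms by (auto simp: pd_mat_def)
    moreover have "0\<^sub>v n \<bullet>c v = 0" using v by simp
    ultimately show False using v by simp
  qed
  \<comment> \<open>The argument \<open>undefined\<close> fills the extension slot of the ring
    record of matrices; it only has to be the same in both facts.\<close>
  from det_non_zero_imp_unit[OF P this, of undefined]
  have "mat_inverse P \<noteq> None" using mat_inverse(1)[OF P, of undefined] by blast
  then show ?thesis using mat_inverse(2)[OF P] that by auto
qed

text \<open>Expand \<open>0 \<le> \<langle>A - sB, P(A - sB)\<rangle>\<close> at \<open>s = \<langle>B, PA\<rangle> / \<langle>B, PB\<rangle>\<close>.\<close>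

lemma psd_Cauchy_Schwarz:
  assumes P: "psd_mat n P" and A: "A \<in> carrier_mat n m" and B: "B \<in> carrier_mat n m"
    and pos: "0 < Re (frob B (P * B))"
  shows "(cmod (frob B (P * A)))\<^sup>2 \<le> Re (frob B (P * B)) * Re (frob A (P * A))"
proof -
  have herm: "hermitian_mat n P" and Pc: "P \<in> carrier_mat n n"
    using P by (auto simp: psd_mat_def hermitian_mat_def)
  define b where "b = Re (frob B (P * B))"
  define z where "z = frob B (P * A)"
  define s where "s = z / of_real b"
  have PA: "P * A \<in> carrier_mat n m" and PB: "P * B \<in> carrier_mat n m"
    and sB: "s \<cdot>\<^sub>m B \<in> carrier_mat n m"
    using Pc A B by auto
  have cz: "frob A (P * B) = cnj z"
    unfolding z_def using A B PA frob_cnj[OF B PA] hermitian_frob[OF herm A B] by simp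
  have "cnj (frob B (P * B)) = frob B (P * B)"
    using frob_cnj[OF B PB] hermitian_frob[OF herm B B] by simp
  then have bb: "frob B (P * B) = of_real b"
    unfolding b_def by (metis Reals_cnj_iff of_real_Re)
  have b: "b > 0" using pos by (simp add: b_def)
  have "P * (A - s \<cdot>\<^sub>m B) = P * A - s \<cdot>\<^sub>m (P * B)"
    using Pc A B sB by (simp add: mult_minus_distrib_mat mult_smult_distrib)
  moreover have "P * A - s \<cdot>\<^sub>m (P * B) \<in> carrier_mat n m"
    using PB by (intro minus_carrier_mat) simp
  ultimately have "frob (A - s \<cdot>\<^sub>m B) (P * (A - s \<cdot>\<^sub>m B)) = frob A (P * A) - s * frob A (P * B)
      - cnj s * (frob B (P * A) - s * frob B (P * B))"
    using A B PA PB sB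
    by (simp add: frob_diff_left[of _ n m] frob_diff_right[of _ n m]
        frob_smult_left[of _ n m] frob_smult_right[of _ n m] algebra_simps)
  also have "\<dots> = frob A (P * A) - of_real ((cmod z)\<^sup>2 / b)"
    unfolding cz bb s_def using b
    by (simp add: z_def[symmetric] complex_norm_square divide_simps del: of_real_power)
  finally have "0 \<le> Re (frob A (P * A)) - (cmod z)\<^sup>2 / b"
    using psd_frob_nonneg[OF P, of "A - s \<cdot>\<^sub>m B" m] A sB
    by (metis Re_complex_of_real minus_carrier_mat minus_complex.sel(1))
  then show ?thesis using b by (simp add: b_def z_def field_simps)
qed


text \<open>Moving the outer left factor \<open>X\<close> to the first argument leaves the form of
  \<open>P\<close> at \<open>X^H G\<close>, so definiteness of \<open>P\<close> passes to
  \<open>X P X^H\<close>. Both the signal term and the sensor noise terms of the error have this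
  shape.\<close>

lemma frob_conjugation:
  assumes "X \<in> carrier_mat n k" "P \<in> carrier_mat k k" "G \<in> carrier_mat n m"
  shows "frob G (X * P * mat_adjoint X * G) = frob (mat_adjoint X * G) (P * (mat_adjoint X * G))"
proof -
  have "X * P * mat_adjoint X * G = X * (P * (mat_adjoint X * G))"
    using assms by (simp add: assoc_mult_mat[of _ n k _ k _ m] assoc_mult_mat[of _ n k _ k _ n]
        assoc_mult_mat[of _ k k _ n _ m] assoc_mult_mat[of _ n k _ n _ m])
  moreover have "P * (mat_adjoint X * G) \<in> carrier_mat k m"
    using assms by auto
  ultimately show ?thesis
    using assms frob_mult_right[of G n m X k] by simp
qed

lemma hermitian_conjugation:
  assumes "hermitian_mat k P" "X \<in> carrier_mat n k"
  shows "hermitian_mat n (X * P * mat_adjoint X)"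
proof -
  have P: "P \<in> carrier_mat k k" "mat_adjoint P = P"
    using assms by (auto simp: hermitian_mat_def)
  have "mat_adjoint (X * P * mat_adjoint X) = X * (P * mat_adjoint X)"
    using P assms(2) mat_adjoint_mult[of "X * P" n k "mat_adjoint X" n] mat_adjoint_mult[of X n k P k]
    by simp
  also have "\<dots> = X * P * mat_adjoint X"
    using P assms(2) by (simp add: assoc_mult_mat[of _ n k _ k _ n])
  finally show ?thesis
    using P assms(2) by (auto simp: hermitian_mat_def)
qed

lemma psd_conjugation:
  assumes "psd_mat k P" "X \<in> carrier_mat n k"
  shows "psd_mat n (X * P * mat_adjoint X)"
proof (rule psd_matI)
  show "hermitian_mat n (X * P * mat_adjoint X)"
    using assms hermitian_conjugation by (auto simp: psd_mat_def)
  fix A :: "complex mat" assume A: "A \<in> carrier_mat n 1"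
  have P: "P \<in> carrier_mat k k" using assms by (auto simp: psd_mat_def hermitian_mat_def)
  have "mat_adjoint X * A \<in> carrier_mat k 1" using assms A by auto
  then show "0 \<le> Re (frob A (X * P * mat_adjoint X * A))"
    unfolding frob_conjugation[OF assms(2) P A] by (rule psd_frob_nonneg[OF assms(1)])
qed

lemma hermitian_add:
  "hermitian_mat n P \<Longrightarrow> hermitian_mat n Q \<Longrightarrow> hermitian_mat n (P + Q)"
  by (auto simp: hermitian_mat_def mat_adjoint_add[of _ n n])

lemma hermitian_mat_sum:
  "(\<And>i. i \<in> I \<Longrightarrow> hermitian_mat n (A i)) \<Longrightarrow> hermitian_mat n (mat_sum n n A I)"
  by (auto simp: hermitian_mat_def mat_adjoint_mat_sum intro: mat_sum_cong)

lemma pd_add_psd: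
  assumes "pd_mat n P" "psd_mat n Q"
  shows "pd_mat n (P + Q)"
  unfolding pd_mat_def
proof (intro conjI ballI impI)
  show "hermitian_mat n (P + Q)"
    using assms by (auto simp: pd_mat_def psd_mat_def intro: hermitian_add)
  fix v :: "complex vec" assume v: "v \<in> carrier_vec n" "v \<noteq> 0\<^sub>v n"
  have P: "P \<in> carrier_mat n n" and Q: "Q \<in> carrier_mat n n"
    using assms by (auto simp: pd_mat_def psd_mat_def hermitian_mat_def)
  have "((P + Q) *\<^sub>v v) \<bullet>c v = (P *\<^sub>v v) \<bullet>c v + (Q *\<^sub>v v) \<bullet>c v"
    using P Q v by (simp add: add_mult_distrib_mat_vec[of _ n n] add_scalar_prod_distrib[of _ n])
  moreover have "0 < Re ((P *\<^sub>v v) \<bullet>c v)" "0 \<le> Re ((Q *\<^sub>v v) \<bullet>c v)"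
    using assms v by (auto simp: pd_mat_def psd_mat_def)
  ultimately show "0 < Re (((P + Q) *\<^sub>v v) \<bullet>c v)" by simp
qed

text \<open>Tailored to the received covariance, where the receiver noise supplies such a bound with
  \<open>c\<close> equal to its variance.\<close>

lemma pd_matI_frob:
  assumes P: "hermitian_mat n P" and c: "0 < c"
    and ge: "\<And>A. A \<in> carrier_mat n 1 \<Longrightarrow> c * Re (frob A A) \<le> Re (frob A (P * A))"
  shows "pd_mat n P"
  unfolding pd_mat_def
proof (intro conjI ballI impI)
  fix v :: "complex vec" assume v: "v \<in> carrier_vec n" "v \<noteq> 0\<^sub>v n"
  define A where "A = mat_of_cols n [v]"
  have A: "A \<in> carrier_mat n 1"
    unfolding A_def by (simp add: mat_of_cols_carrier(1)[of n "[v]", simplified])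
  have "frob A A = v \<bullet>c v"
    using quad_form_eq_frob[of "1\<^sub>m n" n v] v A by (simp add: A_def)
  moreover have "0 < v \<bullet>c v" using v by (simp add: conjugate_square_greater_0_vec[of _ n])
  ultimately have "0 < Re (frob A A)" by (simp add: less_complex_def)
  with c have "0 < Re (frob A (P * A))"
    using ge[OF A] by (meson less_le_trans mult_pos_pos)
  then show "0 < Re ((P *\<^sub>v v) \<bullet>c v)"
    using quad_form_eq_frob[of P n v] P v by (simp add: A_def hermitian_mat_def)
qed fact

text \<open>A nonzero matrix has a nonzero column; that column contributes a positive summand and
  the others nonnegative ones.\<close>

lemma pd_frob_pos:
  assumes P: "pd_mat n P" and A: "A \<in> carrier_mat n m" "A \<noteq> 0\<^sub>m n m"
  shows "0 < Re (frob A (P * A))"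
proof -
  have Pc: "P \<in> carrier_mat n n" using P by (auto simp: pd_mat_def hermitian_mat_def)
  obtain a b where ab: "a < n" "b < m" "A $$ (a, b) \<noteq> 0"
  proof (rule ccontr)
    assume "\<not> thesis"
    then have "A = 0\<^sub>m n m" using that A(1) by (intro eq_matI) auto
    with A(2) show False by simp
  qed
  then have "col A b \<noteq> 0\<^sub>v n"
    using A(1) by (metis carrier_matD index_col index_zero_vec(1))
  then have "0 < Re ((P *\<^sub>v col A b) \<bullet>c col A b)"
    using P A(1) by (auto simp: pd_mat_def)
  moreover have "0 \<le> Re ((P *\<^sub>v col A c) \<bullet>c col A c)" for c
    using pd_imp_psd[OF P] A(1) by (auto simp: psd_mat_def)
  ultimately have "0 < (\<Sum>b<m. Re ((P *\<^sub>v col A b) \<bullet>c col A b))"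
    using ab(2) by (intro sum_pos2[of _ b]) auto
  then show ?thesis using frob_columns[OF Pc A(1)] by simp
qed

text \<open>An entry of \<open>A\<close> is the linear functional \<open>frob E A\<close> for a
  matrix unit \<open>E\<close>. Solving \<open>C * U = E\<close> turns it into
  \<open>frob U (C * A)\<close>, and Cauchy-Schwarz for the form of \<open>C\<close> gives the bound
  with constant \<open>frob U (C * U)\<close>. Since \<open>E\<close> is nonzero, so is
  \<open>U\<close>, which makes this constant positive.\<close>

lemma pd_entry_bounded:
  assumes C: "pd_mat n C" and ab: "a < n" "b < m"
  obtains c where "0 < c" "\<And>A. A \<in> carrier_mat n m \<Longrightarrow> (cmod (A $$ (a, b)))\<^sup>2 \<le> c * Re (frob A (C * A))"
proof -
  have Cc: "C \<in> carrier_mat n n" and herm: "hermitian_mat n C"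
    using C by (auto simp: pd_mat_def hermitian_mat_def)
  obtain Q where Q: "Q \<in> carrier_mat n n" "C * Q = 1\<^sub>m n" using pd_mat_inverse[OF C] by blast
  define E :: "complex mat" where "E = mat n m (\<lambda>k. if k = (a, b) then 1 else 0)"
  have E: "E \<in> carrier_mat n m" by (simp add: E_def)
  define U where "U = Q * E"
  have U: "U \<in> carrier_mat n m" using Q E by (auto simp: U_def)
  have CU: "C * U = E"
    unfolding U_def using assoc_mult_mat[OF Cc Q(1) E] Q(2) left_mult_one_mat[OF E] by simp
  have "U \<noteq> 0\<^sub>m n m"
  proof
    assume "U = 0\<^sub>m n m"
    then have "E = 0\<^sub>m n m" using CU Cc by simp
    then have "E $$ (a, b) = 0" using ab by simp
    then show False using ab by (simp add: E_def)
  qed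
  with pd_frob_pos[OF C U] have pos: "0 < Re (frob U (C * U))" by blast
  show thesis
  proof (rule that[OF pos])
    fix A :: "complex mat" assume A: "A \<in> carrier_mat n m"
    have "frob U (C * A) = frob E A"
      using hermitian_frob[OF herm U A] CU by simp
    also have "\<dots> = (\<Sum>q<m. \<Sum>p<n. if p = a then if q = b then A $$ (a, b) else 0 else 0)"
      using E A unfolding frob_sum[OF E A]
      by (intro sum.cong) (auto simp: E_def)
    also have "\<dots> = A $$ (a, b)"
      using ab by (simp add: sum.delta)
    finally show "(cmod (A $$ (a, b)))\<^sup>2 \<le> Re (frob U (C * U)) * Re (frob A (C * A))"
      using psd_Cauchy_Schwarz[OF pd_imp_psd[OF C] A U pos] by simp
  qed
qed

text \<open>On the line through \<open>A\<close> and \<open>B\<close> the form is a quadratic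
  polynomial in the parameter with leading coefficient \<open>q (B - A)\<close>, which is
  nonnegative.\<close>

lemma psd_frob_convex:
  assumes P: "psd_mat n P" and A: "A \<in> carrier_mat n m" and B: "B \<in> carrier_mat n m"
    and t: "0 \<le> t" "t \<le> 1"
  defines "q \<equiv> \<lambda>A. Re (frob A (P * A))"
  shows "q (A + complex_of_real t \<cdot>\<^sub>m (B - A)) \<le> (1 - t) * q A + t * q B"
proof -
  define D where "D = B - A"
  have Pc: "P \<in> carrier_mat n n" using P by (auto simp: psd_mat_def hermitian_mat_def)
  have D: "D \<in> carrier_mat n m" using A B by (auto simp: D_def intro: minus_carrier_mat)
  have PA: "P * A \<in> carrier_mat n m" and PD: "P * D \<in> carrier_mat n m" using Pc A D by auto
  define k where "k = Re (frob A (P * D) + frob D (P * A))"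
  have expand: "q (A + complex_of_real s \<cdot>\<^sub>m D) = q A + s * k + s\<^sup>2 * q D" for s
  proof -
    have sD: "complex_of_real s \<cdot>\<^sub>m D \<in> carrier_mat n m"
      and sPD: "complex_of_real s \<cdot>\<^sub>m (P * D) \<in> carrier_mat n m" using D PD by auto
    have "P * (A + complex_of_real s \<cdot>\<^sub>m D) = P * A + complex_of_real s \<cdot>\<^sub>m (P * D)"
      using Pc A D sD by (simp add: mult_add_distrib_mat mult_smult_distrib)
    moreover have "P * A + complex_of_real s \<cdot>\<^sub>m (P * D) \<in> carrier_mat n m"
      using PA sPD by simp
    ultimately show ?thesis
      unfolding q_def k_def using A D PA PD sD sPD
      by (simp add: frob_add_left[of _ n m] frob_add_right[of _ n m] frob_smult_left[of _ n m]
          frob_smult_right[of _ n m] power2_eq_square algebra_simps)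
  qed
  \<comment> \<open>The expansion at 1 expresses the mixed term \<open>k\<close> through
    \<open>q A\<close>, \<open>q B\<close> and \<open>q D\<close>; what remains to be shown is
    \<open>t^2 * q D \<le> t * q D\<close>.\<close>
  have "A + complex_of_real 1 \<cdot>\<^sub>m D = B"
    using A B by (intro eq_matI) (auto simp: D_def)
  then have qB: "q B = q A + k + q D" using expand[of 1] by simp
  have "t\<^sup>2 * q D \<le> t * q D"
    using psd_frob_nonneg[OF P D] t
    by (intro mult_right_mono) (auto simp: q_def power2_eq_square mult_left_le_one_le)
  then show ?thesis
    unfolding D_def[symmetric] expand qB by (simp add: algebra_simps)
qed

subsection \<open>Matrix families with entries in an algebra of functions\<close>

text \<open>
  The error is a polynomial in the matrix entries and their conjugates, so it inherits convergence and
  differentiability by one argument, applied to two algebras \<open>Q\<close>.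
\<close>

locale star_algebra =
  fixes Q :: "('x \<Rightarrow> complex) set"
  assumes const: "(\<lambda>_. c) \<in> Q"
    and add: "f \<in> Q \<Longrightarrow> g \<in> Q \<Longrightarrow> (\<lambda>x. f x + g x) \<in> Q"
    and mult: "f \<in> Q \<Longrightarrow> g \<in> Q \<Longrightarrow> (\<lambda>x. f x * g x) \<in> Q"
    and cnj: "f \<in> Q \<Longrightarrow> (\<lambda>x. cnj (f x)) \<in> Q"
begin

lemma diff: "f \<in> Q \<Longrightarrow> g \<in> Q \<Longrightarrow> (\<lambda>x. f x - g x) \<in> Q"
  using add[OF _ mult[OF const[of "-1"]], of f g] by simp

lemma sum: "(\<And>i. i \<in> I \<Longrightarrow> f i \<in> Q) \<Longrightarrow> (\<lambda>x. \<Sum>i\<in>I. f i x) \<in> Q"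
  by (induction I rule: infinite_finite_induct) (auto intro: const add)

definition mats :: "nat \<Rightarrow> nat \<Rightarrow> ('x \<Rightarrow> complex mat) set" where
  "mats n m = {X. (\<forall>x. X x \<in> carrier_mat n m) \<and> (\<forall>a<n. \<forall>b<m. (\<lambda>x. X x $$ (a, b)) \<in> Q)}"

text \<open>Membership concerns entries as functions of \<open>x\<close>. The family
  \<open>f\<close> names such functions in a form to which the closure rules apply; their agreement
  with the entries is then checked pointwise, where the index bounds are available.\<close>

lemma matsI:
  assumes "\<And>x. X x \<in> carrier_mat n m"
    and "\<And>a b. a < n \<Longrightarrow> b < m \<Longrightarrow> f a b \<in> Q"
    and "\<And>a b x. a < n \<Longrightarrow> b < m \<Longrightarrow> X x $$ (a, b) = f a b x"
  shows "X \<in> mats n m"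
proof -
  have "(\<lambda>x. X x $$ (a, b)) = f a b" if "a < n" "b < m" for a b
    using assms(3)[OF that] by auto
  with assms(1,2) show ?thesis by (auto simp: mats_def)
qed

lemma mats_carrier: "X \<in> mats n m \<Longrightarrow> X x \<in> carrier_mat n m"
  and mats_entry: "X \<in> mats n m \<Longrightarrow> a < n \<Longrightarrow> b < m \<Longrightarrow> (\<lambda>x. X x $$ (a, b)) \<in> Q"
  by (auto simp: mats_def)

lemma mats_dim:
  assumes "X \<in> mats n m"
  shows "dim_row (X x) = n" "dim_col (X x) = m"
  using mats_carrier[OF assms, of x] by auto

lemma mats_const: "A \<in> carrier_mat n m \<Longrightarrow> (\<lambda>_. A) \<in> mats n m"
  by (rule matsI[where f = "\<lambda>a b _. A $$ (a, b)"]) (auto intro: const)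

lemma mats_add:
  assumes X: "X \<in> mats n m" and Y: "Y \<in> mats n m"
  shows "(\<lambda>x. X x + Y x) \<in> mats n m"
  using mats_carrier[OF X] mats_carrier[OF Y] mats_dim[OF X] mats_dim[OF Y]
  by (intro matsI[where f = "\<lambda>a b x. X x $$ (a, b) + Y x $$ (a, b)"])
    (auto intro!: add mats_entry[OF X] mats_entry[OF Y])

lemma mats_diff:
  assumes X: "X \<in> mats n m" and Y: "Y \<in> mats n m"
  shows "(\<lambda>x. X x - Y x) \<in> mats n m"
  using mats_carrier[OF X] mats_carrier[OF Y] mats_dim[OF X] mats_dim[OF Y]
  by (intro matsI[where f = "\<lambda>a b x. X x $$ (a, b) - Y x $$ (a, b)"])
    (auto intro!: diff minus_carrier_mat mats_entry[OF X] mats_entry[OF Y])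

lemma mats_smult:
  assumes "f \<in> Q" and X: "X \<in> mats n m"
  shows "(\<lambda>x. f x \<cdot>\<^sub>m X x) \<in> mats n m"
  using mats_carrier[OF X] mats_dim[OF X] assms(1)
  by (intro matsI[where f = "\<lambda>a b x. f x * X x $$ (a, b)"])
    (auto intro!: mult mats_entry[OF X])

lemma mats_adjoint:
  assumes X: "X \<in> mats n m"
  shows "(\<lambda>x. mat_adjoint (X x)) \<in> mats m n"
proof (rule matsI[where f = "\<lambda>a b x. cnj (X x $$ (b, a))"])
  fix a b x assume "a < m" "b < n"
  then show "mat_adjoint (X x) $$ (a, b) = cnj (X x $$ (b, a))"
    using mats_carrier[OF X, of x] by auto
qed (auto intro!: cnj mats_entry[OF X] mats_carrier[OF X])

lemma mats_mult:
  assumes X: "X \<in> mats n k" and Y: "Y \<in> mats k m"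
  shows "(\<lambda>x. X x * Y x) \<in> mats n m"
proof (rule matsI[where f = "\<lambda>a b x. \<Sum>l<k. X x $$ (a, l) * Y x $$ (l, b)"])
  fix a b x assume "a < n" "b < m"
  then show "(X x * Y x) $$ (a, b) = (\<Sum>l<k. X x $$ (a, l) * Y x $$ (l, b))"
    using mats_carrier[OF X, of x] mats_carrier[OF Y, of x]
    by (auto simp: scalar_prod_def lessThan_atLeast0)
qed (auto intro!: sum mult mats_entry[OF X] mats_entry[OF Y]
      mult_carrier_mat[OF mats_carrier[OF X] mats_carrier[OF Y]])

lemma mats_sum:
  assumes "\<And>i. i \<in> I \<Longrightarrow> X i \<in> mats n m"
  shows "(\<lambda>x. mat_sum n m (\<lambda>i. X i x) I) \<in> mats n m"
  by (rule matsI[where f = "\<lambda>a b x. \<Sum>i\<in>I. X i x $$ (a, b)"])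
    (auto intro!: sum mats_entry[OF assms])

lemma mats_trace:
  assumes X: "X \<in> mats n n"
  shows "(\<lambda>x. mat_trace (X x)) \<in> Q"
proof -
  have "(\<lambda>x. mat_trace (X x)) = (\<lambda>x. \<Sum>k<n. X x $$ (k, k))"
    using mats_dim[OF X] by (auto simp: mat_trace_def)
  then show ?thesis by (auto intro!: sum mats_entry[OF X])
qed

end

subsection \<open>The mean square error\<close>

locale wsn_setup =
  fixes W :: wsn
  assumes valid: "valid_wsn W"
begin

abbreviation "K \<equiv> src_dim W"
abbreviation "M \<equiv> rx_dim W"
abbreviation "Cs \<equiv> src_cov W"
abbreviation "power_cov i \<equiv> obs_signal_cov W i + noise_cov W i"

lemma Cs: "psd_mat K Cs" "hermitian_mat K Cs" "Cs \<in> carrier_mat K K" "mat_adjoint Cs = Cs"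
  using valid by (auto simp: valid_wsn_def psd_mat_def hermitian_mat_def)

lemma noise_var: "0 < rx_noise_var W"
  using valid by (simp add: valid_wsn_def)

lemma sensor:
  assumes "i \<in> sensors W"
  shows "obs_mat W i \<in> carrier_mat (obs_dim W i) K"
    and "chan_mat W i \<in> carrier_mat M (tx_dim W i)"
    and "psd_mat (obs_dim W i) (noise_cov W i)"
    and "hermitian_mat (obs_dim W i) (noise_cov W i)"
    and "noise_cov W i \<in> carrier_mat (obs_dim W i) (obs_dim W i)"
  using valid assms by (auto simp: valid_wsn_def psd_mat_def hermitian_mat_def)

lemma precoderD:
  "F \<in> precoders W \<Longrightarrow> i \<in> sensors W \<Longrightarrow> F i \<in> carrier_mat (tx_dim W i) (obs_dim W i)"
  by (simp add: precoders_def)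

lemma S_carrier: "S_mat W F \<in> carrier_mat M K"
  by (simp add: S_mat_def)

lemma obs_signal_cov_psd: "i \<in> sensors W \<Longrightarrow> psd_mat (obs_dim W i) (obs_signal_cov W i)"
  unfolding obs_signal_cov_def using Cs(1) sensor(1) by (rule psd_conjugation)

lemma power_cov_carrier:
  "i \<in> sensors W \<Longrightarrow> power_cov i \<in> carrier_mat (obs_dim W i) (obs_dim W i)"
  using obs_signal_cov_psd sensor(5) by (auto simp: psd_mat_def hermitian_mat_def)

text \<open>Bracketed exactly as in \<open>G_opt\<close>, so that unfolding matches syntactically;
  the symmetric form with \<open>chan_mat W i * F i\<close> on both sides is
  \<open>noise_term_eq\<close>.\<close>

definition noise_term :: "(nat \<Rightarrow> complex mat) \<Rightarrow> nat \<Rightarrow> complex mat" where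
  "noise_term F i = chan_mat W i * F i * noise_cov W i * mat_adjoint (F i) * mat_adjoint (chan_mat W i)"

text \<open>The covariance of the received signal, which is the matrix inverted in
  \<open>G_opt\<close>.\<close>

definition rx_cov :: "(nat \<Rightarrow> complex mat) \<Rightarrow> complex mat" where
  "rx_cov F = S_mat W F * Cs * mat_adjoint (S_mat W F)
     + complex_of_real (rx_noise_var W) \<cdot>\<^sub>m 1\<^sub>m M + mat_sum M M (noise_term F) (sensors W)"

lemma noise_term_eq:
  assumes "F \<in> precoders W" "i \<in> sensors W"
  shows "noise_term F i = (chan_mat W i * F i) * noise_cov W i * mat_adjoint (chan_mat W i * F i)"
proof -
  note c = sensor[OF assms(2)] precoderD[OF assms]
  show ?thesis
    unfolding noise_term_def using c
    by (simp add: mat_adjoint_mult[of _ M "tx_dim W i"]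
        assoc_mult_mat[of _ M "obs_dim W i" _ "tx_dim W i" _ M])
qed

lemma noise_term_carrier:
  assumes "F \<in> precoders W" "i \<in> sensors W"
  shows "noise_term F i \<in> carrier_mat M M"
  unfolding noise_term_def using sensor[OF assms(2)] precoderD[OF assms] by auto

lemma noise_term_psd:
  assumes "F \<in> precoders W" "i \<in> sensors W"
  shows "psd_mat M (noise_term F i)"
  unfolding noise_term_eq[OF assms]
  using sensor[OF assms(2)] precoderD[OF assms] by (intro psd_conjugation) auto

lemma rx_cov_hermitian:
  assumes "F \<in> precoders W"
  shows "hermitian_mat M (rx_cov F)"
proof -
  have "hermitian_mat M (S_mat W F * Cs * mat_adjoint (S_mat W F))"
    using Cs S_carrier by (intro hermitian_conjugation)
  moreover have "hermitian_mat M (complex_of_real (rx_noise_var W) \<cdot>\<^sub>m 1\<^sub>m M)"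
    by (simp add: hermitian_mat_def mat_adjoint_smult)
  moreover have "hermitian_mat M (mat_sum M M (noise_term F) (sensors W))"
    using noise_term_psd[OF assms] by (intro hermitian_mat_sum) (auto simp: psd_mat_def)
  ultimately show ?thesis unfolding rx_cov_def by (intro hermitian_add)
qed

lemma rx_cov_carrier: "rx_cov F \<in> carrier_mat M M"
  unfolding rx_cov_def using S_carrier[of F] Cs by auto

lemma rx_cov_mult:
  assumes "F \<in> precoders W" "G \<in> carrier_mat M m"
  shows "rx_cov F * G = S_mat W F * Cs * mat_adjoint (S_mat W F) * G
     + complex_of_real (rx_noise_var W) \<cdot>\<^sub>m G + mat_sum M m (\<lambda>i. noise_term F i * G) (sensors W)"
proof -
  have c: "S_mat W F * Cs * mat_adjoint (S_mat W F) \<in> carrier_mat M M"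
    using S_carrier[of F] Cs by auto
  have "S_mat W F * Cs * mat_adjoint (S_mat W F) * G \<in> carrier_mat M m"
    using c assms(2) by (rule mult_carrier_mat)
  then show ?thesis
    unfolding rx_cov_def using c assms noise_term_carrier[OF assms(1)]
    by (simp add: assoc_add_mat[of _ M m] add_mult_distrib_mat[of _ M M _ _ m] mat_sum_mult[of _ M m _ _ M]
        mult_smult_assoc_mat[of _ M M _ m])
qed

lemma frob_rx_cov:
  assumes F: "F \<in> precoders W" and G: "G \<in> carrier_mat M m"
  shows "frob G (rx_cov F * G) = frob (mat_adjoint (S_mat W F) * G) (Cs * (mat_adjoint (S_mat W F) * G))
    + of_real (rx_noise_var W) * frob G G + (\<Sum>i\<in>sensors W. frob G (noise_term F i * G))"
proof -
  have c: "S_mat W F * Cs * mat_adjoint (S_mat W F) * G \<in> carrier_mat M m"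
    using S_carrier[of F] Cs G by auto
  have n: "noise_term F i * G \<in> carrier_mat M m" if "i \<in> sensors W" for i
    using noise_term_carrier[OF F that] G by auto
  have "frob G (rx_cov F * G) = frob G (S_mat W F * Cs * mat_adjoint (S_mat W F) * G)
    + of_real (rx_noise_var W) * frob G G + (\<Sum>i\<in>sensors W. frob G (noise_term F i * G))"
    unfolding rx_cov_mult[OF F G] using c n G
    by (simp add: frob_add_right[of _ M m] frob_smult_right[of _ M m] frob_mat_sum_right[of _ M m])
  then show ?thesis using frob_conjugation[OF S_carrier Cs(3) G] by simp
qed

lemma frob_noise_nonneg:
  assumes "F \<in> precoders W" "G \<in> carrier_mat M m"
  shows "0 \<le> Re (\<Sum>i\<in>sensors W. frob G (noise_term F i * G))"
  using psd_frob_nonneg[OF noise_term_psd[OF assms(1)] assms(2)] by (simp add: sum_nonneg)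

text \<open>Dropping the signal and the sensor noise leaves the receiver noise, whose variance is
  positive.\<close>

lemma rx_cov_pd:
  assumes F: "F \<in> precoders W"
  shows "pd_mat M (rx_cov F)"
proof (rule pd_matI_frob[OF rx_cov_hermitian[OF F] noise_var])
  fix A :: "complex mat" assume A: "A \<in> carrier_mat M 1"
  have "mat_adjoint (S_mat W F) * A \<in> carrier_mat K 1"
    using S_carrier[of F] A by auto
  from psd_frob_nonneg[OF Cs(1) this] frob_noise_nonneg[OF F A]
  show "rx_noise_var W * Re (frob A A) \<le> Re (frob A (rx_cov F * A))"
    unfolding frob_rx_cov[OF F A] by simp
qed

lemma G_opt_eq: "G_opt W F = the (mat_inverse (rx_cov F)) * (S_mat W F * Cs)"
  unfolding G_opt_def rx_cov_def noise_term_def by (simp add: Let_def)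

text \<open>The second claim is the normal equation of the receiver problem. From here on the
  optimal receiver enters through it and not through the explicit inverse.\<close>

lemma G_opt:
  assumes F: "F \<in> precoders W"
  shows "G_opt W F \<in> carrier_mat M K" "rx_cov F * G_opt W F = S_mat W F * Cs"
proof -
  obtain Q where Q: "Q \<in> carrier_mat M M" "rx_cov F * Q = 1\<^sub>m M" "mat_inverse (rx_cov F) = Some Q"
    using pd_mat_inverse[OF rx_cov_pd[OF F]] by blast
  have SC: "S_mat W F * Cs \<in> carrier_mat M K" using S_carrier[of F] Cs by auto
  show "G_opt W F \<in> carrier_mat M K" unfolding G_opt_eq Q(3) using Q SC by auto
  have "rx_cov F * (Q * (S_mat W F * Cs)) = rx_cov F * Q * (S_mat W F * Cs)"
    using assoc_mult_mat[OF rx_cov_carrier Q(1) SC] by simp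
  then show "rx_cov F * G_opt W F = S_mat W F * Cs"
    unfolding G_opt_eq Q(3) using Q(2) left_mult_one_mat[OF SC] by simp
qed

text \<open>For fixed precoders the error is a quadratic function of \<open>G\<close> with Hermitian
  quadratic part \<open>rx_cov F\<close> and linear part \<open>S_mat W F * Cs\<close>. The work
  lies in regrouping the long products of the definition.\<close>

lemma MSE_frob:
  assumes F: "F \<in> precoders W" and G: "G \<in> carrier_mat M K"
  shows "MSE W F G = Re (frob G (rx_cov F * G) - frob G (S_mat W F * Cs) - frob (S_mat W F * Cs) G + mat_trace Cs)"
proof -
  define S where "S = S_mat W F"
  have S: "S \<in> carrier_mat M K" by (simp add: S_def S_carrier)
  let ?H = "mat_adjoint G"
  have H: "?H \<in> carrier_mat K M" and SH: "mat_adjoint S \<in> carrier_mat K M" using G S by auto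
  have e1: "?H * S * Cs * mat_adjoint S * G = ?H * (S * Cs * mat_adjoint S * G)"
  proof -
    have T: "S * Cs * mat_adjoint S \<in> carrier_mat M M" using S SH Cs(3) by auto
    show ?thesis
      by (simp only: assoc_mult_mat[OF H T G, symmetric] assoc_mult_mat[OF H S Cs(3)]
          assoc_mult_mat[OF H mult_carrier_mat[OF S Cs(3)] SH])
  qed
  have e2: "?H * S * Cs = ?H * (S * Cs)"
    using H S Cs by (simp add: assoc_mult_mat[of _ K M _ K _ K])
  have e3: "Cs * mat_adjoint S = mat_adjoint (S * Cs)"
    using S Cs by (simp add: mat_adjoint_mult[of _ M K])
  have e4: "?H * chan_mat W i * F i * noise_cov W i * mat_adjoint (F i) * mat_adjoint (chan_mat W i) * G
      = ?H * (noise_term F i * G)" if i: "i \<in> sensors W" for i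
  proof -
    have c: "mat_adjoint (F i) \<in> carrier_mat (obs_dim W i) (tx_dim W i)"
        "mat_adjoint (chan_mat W i) \<in> carrier_mat (tx_dim W i) M"
      using sensor[OF i] precoderD[OF F i] by auto
    note c1 = mult_carrier_mat[OF sensor(2)[OF i] precoderD[OF F i]]
    note c2 = mult_carrier_mat[OF c1 sensor(5)[OF i]]
    note c3 = mult_carrier_mat[OF c2 c(1)]
    note c4 = mult_carrier_mat[OF c3 c(2)]
    \<comment> \<open>All products are rewritten to left-nested form; each use of associativity gets
      its carriers explicitly.\<close>
    show ?thesis
      by (simp only: noise_term_def assoc_mult_mat[OF H c4 G, symmetric] assoc_mult_mat[OF H c3 c(2), symmetric]
          assoc_mult_mat[OF H c2 c(1), symmetric] assoc_mult_mat[OF H c1 sensor(5)[OF i], symmetric]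
          assoc_mult_mat[OF H sensor(2)[OF i] precoderD[OF F i], symmetric])
  qed
  have c: "?H * (S * Cs * mat_adjoint S * G) \<in> carrier_mat K K" "?H * (S * Cs) \<in> carrier_mat K K"
     "mat_adjoint (S * Cs) * G \<in> carrier_mat K K" "?H * G \<in> carrier_mat K K"
    using H G S SH Cs by auto
  note d = minus_carrier_mat[OF c(2), of "?H * (S * Cs * mat_adjoint S * G)"]
    minus_carrier_mat[OF c(3), of "?H * (S * Cs * mat_adjoint S * G) - ?H * (S * Cs)"]
  have n: "?H * (noise_term F i * G) \<in> carrier_mat K K" if "i \<in> sensors W" for i
    using noise_term_carrier[OF F that] G H by auto
  have "MSE W F G = Re (mat_trace (?H * (S * Cs * mat_adjoint S * G) - ?H * (S * Cs) - mat_adjoint (S * Cs) * G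
     + mat_sum K K (\<lambda>i. ?H * (noise_term F i * G)) (sensors W)
     + complex_of_real (rx_noise_var W) \<cdot>\<^sub>m (?H * G) + Cs))"
    unfolding MSE_def Let_def S_def[symmetric] e1
    unfolding e2 e3
    using mat_sum_cong[of "sensors W", OF e4] by simp
  also have "\<dots> = Re (frob G (S * Cs * mat_adjoint S * G) - frob G (S * Cs) - frob (S * Cs) G
     + (\<Sum>i\<in>sensors W. frob G (noise_term F i * G)) + of_real (rx_noise_var W) * frob G G + mat_trace Cs)"
    using c d n Cs
    by (simp add: mat_trace_add[of _ K] mat_trace_diff[of _ K] mat_trace_smult[of _ K]
        mat_trace_mat_sum[of _ _ K] frob_def)
  finally show ?thesis
    using frob_rx_cov[OF F G] frob_conjugation[OF S Cs(3) G] by (simp add: S_def)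
qed

text \<open>Completing the square in \<open>G\<close>: by the normal equation the linear part is
  \<open>R * G0\<close>, so the two errors differ by exactly the form of \<open>R\<close> at
  \<open>G - G0\<close>.\<close>

lemma MSE_G_opt_le:
  assumes F: "F \<in> precoders W" and G: "G \<in> carrier_mat M K"
  shows "MSE W F (G_opt W F) \<le> MSE W F G"
proof -
  define G0 where "G0 = G_opt W F"
  define R where "R = rx_cov F"
  note herm = rx_cov_hermitian[OF F, folded R_def]
  have R: "R \<in> carrier_mat M M" by (simp add: R_def rx_cov_carrier)
  have G0: "G0 \<in> carrier_mat M K" "S_mat W F * Cs = R * G0"
    using G_opt[OF F] by (simp_all add: G0_def R_def)
  have c: "R * G \<in> carrier_mat M K" "R * G0 \<in> carrier_mat M K" "G - G0 \<in> carrier_mat M K"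
    using R G G0 by auto
  have "0 \<le> Re (frob (G - G0) (R * (G - G0)))"
    using psd_frob_nonneg[OF pd_imp_psd[OF rx_cov_pd[OF F]] c(3)] by (simp add: R_def)
  also have "R * (G - G0) = R * G - R * G0"
    using R G G0 by (simp add: mult_minus_distrib_mat)
  also have "frob (G - G0) (R * G - R * G0)
      = frob G (R * G) - frob G (R * G0) - frob G0 (R * G) + frob G0 (R * G0)"
    using c G G0(1) by (simp add: frob_diff_left[of _ M K] frob_diff_right[of _ M K] minus_carrier_mat)
  finally show ?thesis
    unfolding MSE_frob[OF F G] MSE_frob[OF F G0(1), unfolded G0_def] G0(2)
    using hermitian_frob[OF herm G0(1) G] hermitian_frob[OF herm G0(1) G0(1)] 
    by (simp add: G0_def R_def)
qed

text \<open>Completing the square in the other way: the error is that of the residual \<open>S\<^sup>H G - I\<close>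
  plus the two noise contributions.\<close>

lemma MSE_ge:
  assumes F: "F \<in> precoders W" and G: "G \<in> carrier_mat M K"
  shows "rx_noise_var W * Re (frob G G) \<le> MSE W F G"
proof -
  define S where "S = S_mat W F"
  have S: "S \<in> carrier_mat M K" by (simp add: S_def S_carrier)
  define U where "U = mat_adjoint S * G"
  have U: "U \<in> carrier_mat K K" using S G by (auto simp: U_def)
  have c: "Cs * U \<in> carrier_mat K K" "U - 1\<^sub>m K \<in> carrier_mat K K" using U Cs by auto
  have f1: "frob G (S * Cs) = frob U Cs"
    unfolding U_def using S G Cs by (intro frob_mult_right) auto
  have f2: "frob (S * Cs) G = frob Cs U"
    using f1 frob_cnj[of G M K "S * Cs"] frob_cnj[OF U Cs(3)] S G Cs by auto
  have f3: "frob (1\<^sub>m K) (Cs * U) = frob Cs U"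
    using hermitian_frob[OF Cs(2), of "1\<^sub>m K" K U] U Cs by simp
  have f4: "frob (1\<^sub>m K) Cs = mat_trace Cs" using Cs by (simp add: frob_def)
  have "0 \<le> Re (frob (U - 1\<^sub>m K) (Cs * (U - 1\<^sub>m K)))"
    using psd_frob_nonneg[OF Cs(1) c(2)] .
  also have "Cs * (U - 1\<^sub>m K) = Cs * U - Cs"
    using Cs U by (simp add: mult_minus_distrib_mat)
  also have "frob (U - 1\<^sub>m K) (Cs * U - Cs) = frob U (Cs * U) - frob U Cs - frob Cs U + mat_trace Cs"
    using c U Cs by (simp add: frob_diff_left[of _ K K] frob_diff_right[of _ K K] minus_carrier_mat f3 f4)
  finally show ?thesis
    unfolding MSE_frob[OF F G] frob_rx_cov[OF F G] S_def[symmetric] U_def[symmetric] f1 f2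
    using frob_noise_nonneg[OF F G] by simp
qed

text \<open>The zero receiver is the comparison point for bounding optimal receivers: its error does
  not depend on the precoders.\<close>

lemma MSE_zero:
  assumes F: "F \<in> precoders W"
  shows "MSE W F (0\<^sub>m M K) = Re (mat_trace Cs)"
proof -
  have "frob (0\<^sub>m M K) A = 0" "frob A (0\<^sub>m M K) = 0" if "A \<in> carrier_mat M K" for A
    using that by (auto simp: frob_sum[of _ M K])
  then show ?thesis
    using MSE_frob[OF F, of "0\<^sub>m M K"] S_carrier[of F] Cs rx_cov_carrier[of F] by simp
qed

end

section \<open>Continuity and differentiability of the error\<close>

lemma (in star_algebra) S_mat_mats:
  assumes W: "valid_wsn W"
    and F: "\<And>i. i \<in> sensors W \<Longrightarrow> (\<lambda>x. F x i) \<in> mats (tx_dim W i) (obs_dim W i)"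
  shows "(\<lambda>x. S_mat W (F x)) \<in> mats (rx_dim W) (src_dim W)"
proof -
  interpret wsn_setup W by unfold_locales fact
  show ?thesis
    unfolding S_mat_def
  proof (rule mats_sum)
    fix i assume i: "i \<in> sensors W"
    show "(\<lambda>x. chan_mat W i * F x i * obs_mat W i) \<in> mats M K"
      by (rule mats_mult[OF mats_mult[OF mats_const[OF sensor(2)[OF i]] F[OF i]]
          mats_const[OF sensor(1)[OF i]]])
  qed
qed

text \<open>The algebra consists of complex functions, whereas the error is real; hence the witness
  \<open>q\<close>, the trace before \<open>Re\<close> is applied. The nested rules follow the
  syntax of the definition.\<close>

lemma (in star_algebra) MSE_mats:
  assumes W: "valid_wsn W"
    and F: "\<And>i. i \<in> sensors W \<Longrightarrow> (\<lambda>x. F x i) \<in> mats (tx_dim W i) (obs_dim W i)"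
    and G: "G \<in> mats (rx_dim W) (src_dim W)"
  obtains q where "q \<in> Q" "\<And>x. MSE W (F x) (G x) = Re (q x)"
proof -
  interpret wsn_setup W by unfold_locales fact
  note S = S_mat_mats[OF W F]
  note Cs' = mats_const[OF Cs(3)]
  note H = mats_adjoint[OF G]
  have N: "(\<lambda>x. mat_adjoint (G x) * chan_mat W i * F x i * noise_cov W i * mat_adjoint (F x i)
      * mat_adjoint (chan_mat W i) * G x) \<in> mats K K" if i: "i \<in> sensors W" for i
    by (intro mats_mult[OF mats_mult[OF mats_mult[OF mats_mult[OF mats_mult[OF mats_mult[OF H
        mats_const[OF sensor(2)[OF i]]] F[OF i]] mats_const[OF sensor(5)[OF i]]] mats_adjoint[OF F[OF i]]]
        mats_const[OF mat_adjoint_carrier[OF sensor(2)[OF i]]]] G])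
  show ?thesis
    by (rule that[OF mats_trace[OF mats_add[OF mats_add[OF mats_add[OF mats_diff[OF mats_diff[OF
      mats_mult[OF mats_mult[OF mats_mult[OF mats_mult[OF H S] Cs'] mats_adjoint[OF S]] G]
      mats_mult[OF mats_mult[OF H S] Cs']]
      mats_mult[OF mats_mult[OF Cs' mats_adjoint[OF S]] G]]
      mats_sum[OF N]]
      mats_smult[OF const mats_mult[OF H G]]] Cs']]])
      (simp_all add: MSE_def Let_def)
qed

lemma (in star_algebra) power_mats:
  assumes "F \<in> mats n m" "C \<in> carrier_mat m m"
  shows "(\<lambda>x. mat_trace (F x * C * mat_adjoint (F x))) \<in> Q"
  using assms by (intro mats_trace[of _ n] mats_mult[of _ n m] mats_adjoint mats_const)

text \<open>A sequence with its limit is a single matrix family indexed by \<^typ>\<open>nat option\<close>, the limit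
  sitting at \<^const>\<open>None\<close>.\<close>

interpretation seq_lim: star_algebra "{q. (\<lambda>n. q (Some n)) \<longlonglongrightarrow> q (None :: nat option)}"
  by unfold_locales (auto intro: tendsto_intros)

lemma seq_lim_mats:
  assumes "mat_tendsto X A" "A \<in> carrier_mat n m" "\<And>k. X k \<in> carrier_mat n m"
  shows "case_option A X \<in> seq_lim.mats n m"
  using assms by (auto simp: seq_lim.mats_def mat_tendsto_def split: option.split)

lemma MSE_tendsto:
  assumes W: "valid_wsn W"
    and F: "\<And>k. F k \<in> precoders W" "F' \<in> precoders W"
      "\<And>i. i \<in> sensors W \<Longrightarrow> mat_tendsto (\<lambda>k. F k i) (F' i)"
    and G: "\<And>k. G k \<in> receivers W" "G' \<in> receivers W" "mat_tendsto G G'"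
  shows "(\<lambda>k. MSE W (F k) (G k)) \<longlonglongrightarrow> MSE W F' G'"
proof -
  define F\<^sub>o where "F\<^sub>o = case_option F' F"
  define G\<^sub>o where "G\<^sub>o = case_option G' G"
  have "(\<lambda>x. F\<^sub>o x i) \<in> seq_lim.mats (tx_dim W i) (obs_dim W i)" if "i \<in> sensors W" for i
  proof -
    have "(\<lambda>x. F\<^sub>o x i) = case_option (F' i) (\<lambda>k. F k i)"
      by (auto simp: F\<^sub>o_def split: option.split)
    then show ?thesis
      using seq_lim_mats[OF F(3)[OF that]] F(1,2) that by (auto simp: precoders_def)
  qed
  moreover have "G\<^sub>o \<in> seq_lim.mats (rx_dim W) (src_dim W)"
    unfolding G\<^sub>o_def using seq_lim_mats[OF G(3)] G(1,2) by (auto simp: receivers_def)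
  ultimately obtain q where q: "(\<lambda>n. q (Some n)) \<longlonglongrightarrow> q None"
    "\<And>x. MSE W (F\<^sub>o x) (G\<^sub>o x) = Re (q x)"
    using seq_lim.MSE_mats[OF W, of F\<^sub>o G\<^sub>o] by blast
  from q(2)[of None] q(2)[of "Some _"] q(1) show ?thesis
    by (auto simp: F\<^sub>o_def G\<^sub>o_def intro: tendsto_Re)
qed

lemma power_tendsto:
  assumes "mat_tendsto X A" "A \<in> carrier_mat n m" "\<And>k. X k \<in> carrier_mat n m" "C \<in> carrier_mat m m"
  shows "(\<lambda>k. Re (mat_trace (X k * C * mat_adjoint (X k)))) \<longlonglongrightarrow> Re (mat_trace (A * C * mat_adjoint A))"
  using seq_lim.power_mats[OF seq_lim_mats[OF assms(1-3)] assms(4)]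
  by (auto intro: tendsto_Re)

text \<open>The second algebra. Differentiability is meant over the reals, so conjugation, a bounded
  real-linear map, preserves it.\<close>

interpretation smooth: star_algebra "{q :: 'a::real_normed_vector \<Rightarrow> complex. q differentiable at a}" for a
proof (unfold_locales, goal_cases)
  case (4 f)
  then show ?case
    by (auto simp: differentiable_def intro: bounded_linear.has_derivative[OF bounded_linear_cnj])
qed auto

lemma line_mats:
  assumes "A \<in> carrier_mat n m" "B \<in> carrier_mat n m"
    and "\<And>a. p \<in> {q. q differentiable at a}"
  shows "(\<lambda>x. A + p x \<cdot>\<^sub>m (B - A)) \<in> smooth.mats a n m"
  using assms by (intro smooth.mats_add smooth.mats_const smooth.mats_smult) (auto intro: minus_carrier_mat)

text \<open>Separate parameters for the two blocks: the joint direction of a stationary point is the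
  diagonal of this plane, and total differentiability lets the derivative there be split into the
  two block derivatives.\<close>

lemma MSE_plane_differentiable:
  assumes W: "valid_wsn W"
    and F: "F \<in> precoders W" "F' \<in> precoders W" and G: "G \<in> receivers W" "G' \<in> receivers W"
  shows "(\<lambda>x :: real \<times> real. MSE W (\<lambda>i. F i + complex_of_real (fst x) \<cdot>\<^sub>m (F' i - F i))
             (G + complex_of_real (snd x) \<cdot>\<^sub>m (G' - G))) differentiable at a"
proof -
  have d: "(\<lambda>x :: real \<times> real. complex_of_real (fst x)) differentiable at b"
    "(\<lambda>x :: real \<times> real. complex_of_real (snd x)) differentiable at b" for b
    by (auto simp: differentiable_def intro!: exI derivative_eq_intros)
  obtain q where q: "q \<in> {q. q differentiable at a}"
    "\<And>x. MSE W (\<lambda>i. F i + complex_of_real (fst x) \<cdot>\<^sub>m (F' i - F i))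
             (G + complex_of_real (snd x) \<cdot>\<^sub>m (G' - G)) = Re (q x)"
    by (rule smooth.MSE_mats[OF W, of "\<lambda>x i. F i + complex_of_real (fst x) \<cdot>\<^sub>m (F' i - F i)" a
          "\<lambda>x. G + complex_of_real (snd x) \<cdot>\<^sub>m (G' - G)"])
      (use F G d in \<open>auto simp: precoders_def receivers_def intro!: line_mats\<close>)
  then show ?thesis
    by (auto simp: differentiable_def intro: bounded_linear.has_derivative[OF bounded_linear_Re])
qed

subsection \<open>Convergent subsequences\<close>

text \<open>One Bolzano-Weierstrass extraction per index; passing to a further subsequence keeps the
  limits already obtained.\<close>

lemma common_convergent_subseq:
  fixes x :: "'k \<Rightarrow> nat \<Rightarrow> complex"
  assumes "finite I" "\<And>k n. k \<in> I \<Longrightarrow> cmod (x k n) \<le> B k"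
  shows "\<exists>r l. strict_mono (r :: nat \<Rightarrow> nat) \<and> (\<forall>k\<in>I. (\<lambda>n. x k (r n)) \<longlonglongrightarrow> l k)"
  using assms
proof (induction I)
  case empty
  show ?case by (auto intro!: exI[of _ id] strict_monoI)
next
  case (insert k I)
  then obtain r l where r: "strict_mono r" "\<forall>k\<in>I. (\<lambda>n. x k (r n)) \<longlonglongrightarrow> l k" by auto
  have "\<forall>n. cmod (x k (r n)) \<le> B k" using insert.prems by simp
  then obtain s z where s: "strict_mono (s :: nat \<Rightarrow> nat)" "\<forall>e>0. \<exists>N. \<forall>n\<ge>N. cmod (x k (r (s n)) - z) < e"
    using Bolzano_Weierstrass_complex_disc[of "\<lambda>n. x k (r n)" "B k"] by blast
  have "(\<lambda>n. x k (r (s n))) \<longlonglongrightarrow> z" using s(2) by (simp add: LIMSEQ_iff)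
  moreover have "(\<lambda>n. x i (r (s n))) \<longlonglongrightarrow> l i" if "i \<in> I" for i
    using LIMSEQ_subseq_LIMSEQ[OF _ s(1), of "\<lambda>n. x i (r n)"] r(2) that by (auto simp: o_def)
  moreover have "strict_mono (\<lambda>n. r (s n))" using r(1) s(1) by (simp add: strict_mono_def)
  ultimately show ?case
    using insert.hyps by (intro exI[of _ "\<lambda>n. r (s n)"] exI[of _ "l(k := z)"]) auto
qed

text \<open>All entries of all matrices are flattened into the finite index set \<open>J\<close>, so
  a single subsequence serves the whole family.\<close>

lemma common_convergent_subseq_mat:
  assumes I: "finite I"
    and bnd: "\<And>i a b. i \<in> I \<Longrightarrow> a < d i \<Longrightarrow> b < e i \<Longrightarrow> \<exists>B. \<forall>n. cmod (X i n $$ (a, b)) \<le> B"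
  shows "\<exists>r A. strict_mono (r :: nat \<Rightarrow> nat) \<and>
    (\<forall>i\<in>I. A i \<in> carrier_mat (d i) (e i) \<and> mat_tendsto (\<lambda>n. X i (r n)) (A i))"
proof -
  define J where "J = (SIGMA i:I. {..<d i} \<times> {..<e i})"
  have "finite J" using I by (auto simp: J_def)
  have "\<forall>k\<in>J. \<exists>B. \<forall>n. cmod (case k of (i, a, b) \<Rightarrow> X i n $$ (a, b)) \<le> B"
    using bnd by (auto simp: J_def)
  then obtain B where "\<forall>k\<in>J. \<forall>n. cmod (case k of (i, a, b) \<Rightarrow> X i n $$ (a, b)) \<le> B k"
    by metis
  then obtain r l where r: "strict_mono (r :: nat \<Rightarrow> nat)"
    "\<forall>k\<in>J. (\<lambda>n. case k of (i, a, b) \<Rightarrow> X i (r n) $$ (a, b)) \<longlonglongrightarrow> l k"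
    using common_convergent_subseq[OF \<open>finite J\<close>, of "\<lambda>k n. case k of (i, a, b) \<Rightarrow> X i n $$ (a, b)" B]
    by auto
  show ?thesis
    using r by (intro exI[of _ r] exI[of _ "\<lambda>i. mat (d i) (e i) (\<lambda>(a, b). l (i, a, b))"])
      (auto simp: mat_tendsto_def J_def)
qed

subsection \<open>Limit points of the iteration\<close>

context wsn_setup
begin

text \<open>The precoder stands to the left of the covariance, while \<open>frob A (P * A)\<close>
  has its argument on the right. Convexity and entry bounds are therefore applied to the adjoint of
  \<open>F i\<close>.\<close>

lemma power_eq_frob:
  assumes "F \<in> precoders W" "i \<in> sensors W"
  shows "mat_trace (F i * power_cov i * mat_adjoint (F i))
    = frob (mat_adjoint (F i)) (power_cov i * mat_adjoint (F i))"
  unfolding frob_def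
  using precoderD[OF assms] power_cov_carrier[OF assms(2)]
    assoc_mult_mat[of "F i" "tx_dim W i" "obs_dim W i" "power_cov i" "obs_dim W i" "mat_adjoint (F i)" "tx_dim W i"]
  by simp

lemma power_cov_psd: "i \<in> sensors W \<Longrightarrow> psd_mat (obs_dim W i) (power_cov i)"
proof -
  assume i: "i \<in> sensors W"
  note p = obs_signal_cov_psd[OF i] sensor(3)[OF i]
  have c: "obs_signal_cov W i \<in> carrier_mat (obs_dim W i) (obs_dim W i)"
    "noise_cov W i \<in> carrier_mat (obs_dim W i) (obs_dim W i)"
    using p by (auto simp: psd_mat_def hermitian_mat_def)
  show ?thesis
  proof (rule psd_matI)
    show "hermitian_mat (obs_dim W i) (power_cov i)"
      using p by (auto simp: psd_mat_def intro: hermitian_add)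
    fix A :: "complex mat" assume A: "A \<in> carrier_mat (obs_dim W i) 1"
    have "power_cov i * A = obs_signal_cov W i * A + noise_cov W i * A"
      using c A by (simp add: add_mult_distrib_mat)
    moreover have "obs_signal_cov W i * A \<in> carrier_mat (obs_dim W i) 1"
      "noise_cov W i * A \<in> carrier_mat (obs_dim W i) 1" using c A by auto
    ultimately show "0 \<le> Re (frob A (power_cov i * A))"
      using psd_frob_nonneg[OF p(1) A] psd_frob_nonneg[OF p(2) A] A
      by (simp add: frob_add_right[of _ "obs_dim W i" 1])
  qed
qed

lemma feasible_convex:
  assumes F: "feasible W F" and F': "feasible W F'" and t: "0 \<le> t" "t \<le> 1"
  shows "feasible W (\<lambda>i. F i + complex_of_real t \<cdot>\<^sub>m (F' i - F i))" (is "feasible W ?H")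
proof -
  have p: "F \<in> precoders W" "F' \<in> precoders W" using F F' by (auto simp: feasible_def)
  have H: "?H \<in> precoders W"
    using p by (auto simp: precoders_def intro!: add_carrier_mat smult_carrier_mat minus_carrier_mat)
  moreover have "Re (mat_trace (?H i * power_cov i * mat_adjoint (?H i))) \<le> tx_power W i"
    if i: "i \<in> sensors W" for i
  proof -
    let ?J = "obs_dim W i" and ?N = "tx_dim W i"
    have c: "F i \<in> carrier_mat ?N ?J" "F' i \<in> carrier_mat ?N ?J" using precoderD p i by auto
    \<comment> \<open>The parameter \<open>t\<close> is real, so conjugation leaves it unchanged and
      segments are mapped to segments.\<close>
    have adj: "mat_adjoint (?H i)
        = mat_adjoint (F i) + complex_of_real t \<cdot>\<^sub>m (mat_adjoint (F' i) - mat_adjoint (F i))"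
      using c by (intro eq_matI) auto
    have "Re (mat_trace (?H i * power_cov i * mat_adjoint (?H i)))
      \<le> (1 - t) * Re (mat_trace (F i * power_cov i * mat_adjoint (F i)))
        + t * Re (mat_trace (F' i * power_cov i * mat_adjoint (F' i)))"
      unfolding power_eq_frob[OF H i] power_eq_frob[OF p(1) i] power_eq_frob[OF p(2) i]
      unfolding adj
      using c t by (intro psd_frob_convex[OF power_cov_psd[OF i]]) auto
    also have "\<dots> \<le> (1 - t) * tx_power W i + t * tx_power W i"
      using F F' i t by (intro add_mono mult_left_mono) (auto simp: feasible_def)
    finally show ?thesis by (simp add: algebra_simps)
  qed
  ultimately show ?thesis by (simp add: feasible_def)
qed

text \<open>One positive definite summand makes the whole power covariance positive definite, and
  then the power controls every entry of the adjoint; hence the swapped indices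
  \<open>(b, a)\<close>.\<close>

lemma feasible_entry_bounded:
  assumes pd: "pd_mat (obs_dim W i) (obs_signal_cov W i) \<or> pd_mat (obs_dim W i) (noise_cov W i)"
    and i: "i \<in> sensors W" and ab: "a < tx_dim W i" "b < obs_dim W i"
  obtains B where "\<And>F. feasible W F \<Longrightarrow> cmod (F i $$ (a, b)) \<le> B"
proof -
  let ?J = "obs_dim W i"
  note p = obs_signal_cov_psd[OF i] sensor(3)[OF i]
  have "obs_signal_cov W i \<in> carrier_mat ?J ?J" using p(1) by (auto simp: psd_mat_def hermitian_mat_def)
  then have "power_cov i = noise_cov W i + obs_signal_cov W i"
    using comm_add_mat sensor(5)[OF i] by blast
  then have "pd_mat ?J (power_cov i)"
    using pd pd_add_psd[OF _ p(2)] pd_add_psd[OF _ p(1)] by metis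
  then obtain c where c: "0 < c"
    "\<And>A. A \<in> carrier_mat ?J (tx_dim W i) \<Longrightarrow> (cmod (A $$ (b, a)))\<^sup>2 \<le> c * Re (frob A (power_cov i * A))"
    using pd_entry_bounded[OF _ ab(2) ab(1)] by metis
  show thesis
  proof (rule that)
    fix F assume F: "feasible W F"
    then have p: "F \<in> precoders W"
      and pw: "Re (mat_trace (F i * power_cov i * mat_adjoint (F i))) \<le> tx_power W i"
      using i by (auto simp: feasible_def)
    note Fc = precoderD[OF p i]
    have "(cmod (F i $$ (a, b)))\<^sup>2 = (cmod (mat_adjoint (F i) $$ (b, a)))\<^sup>2"
      using Fc ab by auto
    also have "\<dots> \<le> c * Re (frob (mat_adjoint (F i)) (power_cov i * mat_adjoint (F i)))"
      using Fc by (intro c(2)) auto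
    also have "\<dots> \<le> c * tx_power W i"
      using c(1) pw unfolding power_eq_frob[OF p i] by (intro mult_left_mono) auto
    finally show "cmod (F i $$ (a, b)) \<le> sqrt (c * tx_power W i)"
      by (rule real_le_rsqrt)
  qed
qed

text \<open>The bound is the same for all \<open>F\<close>, hence holds along the entire
  iteration.\<close>

lemma G_opt_entry_bounded:
  assumes F: "F \<in> precoders W" and ab: "a < M" "b < K"
  shows "cmod (G_opt W F $$ (a, b)) \<le> sqrt (Re (mat_trace Cs) / rx_noise_var W)"
proof (rule real_le_rsqrt)
  note G = G_opt(1)[OF F]
  have "rx_noise_var W * (cmod (G_opt W F $$ (a, b)))\<^sup>2
      \<le> rx_noise_var W * Re (frob (G_opt W F) (G_opt W F))"
    using frob_self_ge[OF G ab] noise_var by simp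
  also have "\<dots> \<le> MSE W F (G_opt W F)" by (rule MSE_ge[OF F G])
  also have "\<dots> \<le> MSE W F (0\<^sub>m M K)" by (rule MSE_G_opt_le[OF F]) simp
  also have "\<dots> = Re (mat_trace Cs)" by (rule MSE_zero[OF F])
  finally show "(cmod (G_opt W F $$ (a, b)))\<^sup>2 \<le> Re (mat_trace Cs) / rx_noise_var W"
    using noise_var by (simp add: field_simps)
qed

text \<open>The derivative in the joint direction is the sum of the two block derivatives. In the
  receiver block the whole line is admissible, so the derivative vanishes at the minimum; in the
  precoder block the segment towards \<open>F'\<close> is feasible by convexity, so the one-sided
  derivative is nonnegative.\<close>

lemma stationary_pointI:
  assumes F: "feasible W F" and G: "G \<in> receivers W"
    and F_min: "\<And>F'. feasible W F' \<Longrightarrow> MSE W F G \<le> MSE W F' G"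
    and G_min: "\<And>G'. G' \<in> receivers W \<Longrightarrow> MSE W F G \<le> MSE W F G'"
  shows "stationary_point W F G"
  unfolding stationary_point_def
proof (intro conjI allI impI F G, elim conjE)
  fix F' G' assume F': "feasible W F'" and G': "G' \<in> receivers W"
  define f where "f = (\<lambda>x :: real \<times> real. MSE W (\<lambda>i. F i + complex_of_real (fst x) \<cdot>\<^sub>m (F' i - F i))
             (G + complex_of_real (snd x) \<cdot>\<^sub>m (G' - G)))"
  have p: "F \<in> precoders W" "F' \<in> precoders W" using F F' by (auto simp: feasible_def)
  have "f differentiable at 0"
    unfolding f_def by (rule MSE_plane_differentiable[OF valid p G G'])
  then obtain f' where f': "(f has_derivative f') (at 0)" by (auto simp: differentiable_def)
  then have lin: "linear f'" by (rule has_derivative_linear)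
  have along: "((\<lambda>t. f (t *\<^sub>R u)) has_real_derivative f' u) (at 0)" for u
  proof -
    have "((\<lambda>t. f (t *\<^sub>R u)) has_derivative (\<lambda>t. f' (t *\<^sub>R u))) (at 0)"
      using f' by (intro has_derivative_compose[where f = "\<lambda>t. t *\<^sub>R u" and g = f])
        (auto intro!: derivative_eq_intros)
    then show ?thesis
      by (simp add: has_field_derivative_def linear_scale[OF lin] mult_commute_abs)
  qed
  have GG: "G \<in> carrier_mat M K" "G' \<in> carrier_mat M K" using G G' by (auto simp: receivers_def)
  \<comment> \<open>At parameter 0 the family agrees with \<open>F\<close> only on the sensors,
    since dimensions elsewhere are unconstrained; the error depends on those values alone.\<close>
  have F0: "MSE W (\<lambda>i. F i + complex_of_real 0 \<cdot>\<^sub>m (F' i - F i)) H = MSE W F H" for H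
  proof -
    have "F i + complex_of_real 0 \<cdot>\<^sub>m (F' i - F i) = F i" if "i \<in> sensors W" for i
      using precoderD[OF p(1) that] precoderD[OF p(2) that] by (intro eq_matI) auto
    then show ?thesis
      unfolding MSE_def S_mat_def by (auto simp: Let_def cong: mat_sum_cong)
  qed
  have G0: "G + complex_of_real 0 \<cdot>\<^sub>m (G' - G) = G"
    using GG by (intro eq_matI) auto
  have "f' (0, 1) = 0"
  proof (rule DERIV_local_min)
    show "((\<lambda>t. f (t *\<^sub>R (0, 1))) has_real_derivative f' (0, 1)) (at 0)" by (rule along)
    show "0 < (1 :: real)" by simp
  next
    show "\<forall>y. \<bar>0 - y\<bar> < 1 \<longrightarrow> f (0 *\<^sub>R (0, 1)) \<le> f (y *\<^sub>R (0, 1))"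
    proof (intro allI impI)
      fix y :: real
      have "G + complex_of_real y \<cdot>\<^sub>m (G' - G) \<in> receivers W"
        using GG by (auto simp: receivers_def intro!: add_carrier_mat smult_carrier_mat minus_carrier_mat)
      then show "f (0 *\<^sub>R (0, 1)) \<le> f (y *\<^sub>R (0, 1))"
        unfolding f_def using F0 G0 G_min by simp
    qed
  qed
  moreover have "0 \<le> f' (1, 0)"
  proof (rule ccontr)
    assume "\<not> 0 \<le> f' (1, 0)"
    then obtain d where d: "d > 0" "\<And>h. 0 < h \<Longrightarrow> h < d \<Longrightarrow> f ((0 + h) *\<^sub>R (1, 0)) < f (0 *\<^sub>R (1, 0))"
      using DERIV_neg_dec_right[OF along[of "(1, 0)"]] by force
    \<comment> \<open>Below \<open>d\<close> for the strict decrease, and at most 1 to stay on the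
      feasible segment.\<close>
    define h where "h = min (d / 2) 1"
    have h: "0 < h" "h < d" "h \<le> 1" using d(1) by (auto simp: h_def)
    have "MSE W F G \<le> MSE W (\<lambda>i. F i + complex_of_real h \<cdot>\<^sub>m (F' i - F i)) G"
      using h by (intro F_min feasible_convex[OF F F']) auto
    with d(2)[OF h(1,2)] F0 G0 show False by (simp add: f_def)
  qed
  moreover have "f' (1, 1) = f' (1, 0) + f' (0, 1)"
    using linear_add[OF lin, of "(1, 0)" "(0, 1)"] by simp
  ultimately show "\<exists>D\<ge>0. ((\<lambda>t. MSE W (\<lambda>i. F i + complex_of_real t \<cdot>\<^sub>m (F' i - F i))
      (G + complex_of_real t \<cdot>\<^sub>m (G' - G))) has_real_derivative D) (at 0)"
    using along[of "(1, 1)"] by (intro exI[of _ "f' (1, 1)"]) (simp add: f_def)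
qed

text \<open>The feasible set is closed because the power is continuous in the entries.\<close>

lemma feasible_limit:
  assumes F: "\<And>k. feasible W (F k)" and F': "F' \<in> precoders W"
    and lim: "\<And>i. i \<in> sensors W \<Longrightarrow> mat_tendsto (\<lambda>k. F k i) (F' i)"
  shows "feasible W F'"
  unfolding feasible_def
proof (intro conjI ballI F')
  fix i assume i: "i \<in> sensors W"
  have "F k i \<in> carrier_mat (tx_dim W i) (obs_dim W i)" for k
    using F[of k] i by (auto simp: feasible_def precoders_def)
  from power_tendsto[OF lim[OF i] precoderD[OF F' i] this power_cov_carrier[OF i]]
  show "Re (mat_trace (F' i * power_cov i * mat_adjoint (F' i))) \<le> tx_power W i"
    by (rule LIMSEQ_le_const2) (use F i in \<open>auto simp: feasible_def\<close>)
qed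

end

theorem theorem2:
  fixes W :: wsn
    and F :: "nat \<Rightarrow> nat \<Rightarrow> complex mat"
    and G :: "nat \<Rightarrow> complex mat"
  assumes "valid_wsn W" and "two_bcd W F G"
  shows "(\<forall>j. MSE W (F (Suc j)) (G (Suc j)) \<le> MSE W (F j) (G j)) \<and>
    ((\<forall>i\<in>sensors W. pd_mat (obs_dim W i) (obs_signal_cov W i)
                   \<or> pd_mat (obs_dim W i) (noise_cov W i)) \<longrightarrow>
       (\<exists>F' G'. limit_point W (\<lambda>j. F (Suc j)) (\<lambda>j. G (Suc j)) F' G') \<and>
       (\<forall>F' G'. limit_point W (\<lambda>j. F (Suc j)) (\<lambda>j. G (Suc j)) F' G' \<longrightarrow>
          stationary_point W F' G'))"
proof -
  interpret wsn_setup W by unfold_locales fact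
  have feas: "feasible W (F j)" for j
    using assms(2) by (cases j) (auto simp: two_bcd_def optimal_precoders_def)
  have G_eq: "G j = G_opt W (F j)" for j
    using assms(2) by (cases j) (auto simp: two_bcd_def)
  have F_opt: "MSE W (F (Suc j)) (G j) \<le> MSE W F' (G j)" if "feasible W F'" for F' j
    using assms(2) that by (auto simp: two_bcd_def optimal_precoders_def)
  have prec: "F j \<in> precoders W" for j using feas by (auto simp: feasible_def)
  have recv: "G j \<in> receivers W" for j
    using G_opt(1)[OF prec] by (simp add: G_eq receivers_def)
  have G_min: "MSE W (F j) (G j) \<le> MSE W (F j) G'" if "G' \<in> receivers W" for G' j
    using MSE_G_opt_le[OF prec] that by (simp add: G_eq receivers_def)
  \<comment> \<open>Two half-steps, with intermediate value \<open>MSE W (F (Suc j)) (G j)\<close>: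
    the receiver update follows the precoder update.\<close>
  have dec: "MSE W (F (Suc j)) (G (Suc j)) \<le> MSE W (F j) (G j)" for j
    using G_min[OF recv] F_opt[OF feas] by (rule order_trans)
  have "\<exists>F' G'. limit_point W (\<lambda>j. F (Suc j)) (\<lambda>j. G (Suc j)) F' G'"
    if pd: "\<forall>i\<in>sensors W. pd_mat (obs_dim W i) (obs_signal_cov W i) \<or> pd_mat (obs_dim W i) (noise_cov W i)"
  proof -
    \<comment> \<open>The receiver joins the precoders as the member with index \<open>None\<close>,
      so that one extraction yields a common subsequence.\<close>
    let ?X = "\<lambda>k n. case k of None \<Rightarrow> G (Suc n) | Some i \<Rightarrow> F (Suc n) i"
    have "finite (insert None (Some ` sensors W))" by (simp add: sensors_def)
    then obtain r A where r: "strict_mono (r :: nat \<Rightarrow> nat)"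
      and A: "\<forall>k \<in> insert None (Some ` sensors W).
        A k \<in> carrier_mat (case k of None \<Rightarrow> M | Some i \<Rightarrow> tx_dim W i) (case k of None \<Rightarrow> K | Some i \<Rightarrow> obs_dim W i)
        \<and> mat_tendsto (\<lambda>n. ?X k (r n)) (A k)"
    proof (atomize_elim, rule common_convergent_subseq_mat, goal_cases)
      case (1 k a b)
      then consider "k = None" "a < M" "b < K"
        | i where "k = Some i" "i \<in> sensors W" "a < tx_dim W i" "b < obs_dim W i" by auto
      then show ?case
      proof cases
        case 1
        then show ?thesis using G_opt_entry_bounded[OF prec] by (auto simp: G_eq)
      next
        case 2
        then show ?thesis using feasible_entry_bounded[of i a b] pd feas by (metis option.case(2))
      qed
    qed
    then have "limit_point W (\<lambda>j. F (Suc j)) (\<lambda>j. G (Suc j)) (\<lambda>i. A (Some i)) (A None)"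
      by (auto simp: limit_point_def precoders_def receivers_def)
    then show ?thesis by blast
  qed
  moreover have "stationary_point W F' G'"
    if lp: "limit_point W (\<lambda>j. F (Suc j)) (\<lambda>j. G (Suc j)) F' G'" for F' G'
  proof -
    obtain r where F': "F' \<in> precoders W" and G': "G' \<in> receivers W" and r: "strict_mono (r :: nat \<Rightarrow> nat)"
      and Fl: "\<And>i. i \<in> sensors W \<Longrightarrow> mat_tendsto (\<lambda>n. F (Suc (r n)) i) (F' i)"
      and Gl: "mat_tendsto (\<lambda>n. G (Suc (r n))) G'"
      using lp by (auto simp: limit_point_def)
    have constl: "mat_tendsto (\<lambda>n. A) A" for A by (simp add: mat_tendsto_def)
    have lim: "(\<lambda>n. MSE W (F (Suc (r n))) (G (Suc (r n)))) \<longlonglongrightarrow> MSE W F' G'"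
      by (rule MSE_tendsto[OF assms(1) prec F' Fl recv G' Gl])
    have anti: "MSE W (F k) (G k) \<le> MSE W (F j) (G j)" if "j \<le> k" for j k
      using lift_Suc_antimono_le[of "\<lambda>j. MSE W (F j) (G j)", OF dec that] .
    have below: "MSE W F' G' \<le> MSE W (F j) (G j)" for j
    proof (rule LIMSEQ_le_const2[OF lim], intro exI allI impI)
      fix n assume "j \<le> n"
      \<comment> \<open>A strictly increasing \<open>r\<close> satisfies \<open>n \<le> r n\<close>,
        so from \<open>n = j\<close> on the subsequence has passed index \<open>j\<close>.\<close>
      then have "j \<le> Suc (r n)" using seq_suble[OF r, of n] by simp
      then show "MSE W (F (Suc (r n))) (G (Suc (r n))) \<le> MSE W (F j) (G j)" by (rule anti)
    qed
    show ?thesis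
    proof (rule stationary_pointI)
      show "feasible W F'" using feasible_limit[OF feas F' Fl] .
      show "G' \<in> receivers W" by (rule G')
    next
      fix H assume H: "feasible W H"
      then have Hp: "H \<in> precoders W" by (simp add: feasible_def)
      have "(\<lambda>n. MSE W H (G (Suc (r n)))) \<longlonglongrightarrow> MSE W H G'"
        by (rule MSE_tendsto[OF assms(1) Hp Hp constl recv G' Gl])
      \<comment> \<open>The iterate two steps after \<open>r n\<close> is used: its precoders are
        optimal for the receiver \<open>G (Suc (r n))\<close>, which is the one that converges. The
        middle term of the chain is
        \<open>MSE W (F (Suc (Suc (r n)))) (G (Suc (r n)))\<close>.\<close>
      moreover have "MSE W F' G' \<le> MSE W H (G (Suc (r n)))" for n
        using below[of "Suc (Suc (r n))"] G_min[OF recv] F_opt[OF H] by (meson order_trans)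
      ultimately show "MSE W F' G' \<le> MSE W H G'" using LIMSEQ_le_const by blast
    next
      fix H assume H: "H \<in> receivers W"
      \<comment> \<open>Here precoders and receiver carry the same index, so receiver optimality
        passes directly to the limit on both sides.\<close>
      have "(\<lambda>n. MSE W (F (Suc (r n))) H) \<longlonglongrightarrow> MSE W F' H"
        by (rule MSE_tendsto[OF assms(1) prec F' Fl H H constl])
      from LIMSEQ_le[OF lim this] show "MSE W F' G' \<le> MSE W F' H" using G_min[OF H] by blast
    qed
  qed
  ultimately show ?thesis using dec by blast
qed

end
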